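(* Let $p$ be a prime and let $f(X)=\xi_0+\xi_1X+\dots+\xi_{n-1}X^{n-1}+X^n$ where $\xi_0,\dots,\xi_{n-1}$ are i.i.d. random variables taking values in $\mathbb{Z}_p$. Let $\varepsilon>0$. (1) Assume each $\xi_i$ takes the values $\pm1$ each with equal probability and $p>2$. Then $$\mathbb{E}\left[C_{\mathbb{Q}_p}(f)\right]=\frac{p-1}{p+1}+O\left(n^{-1/4+\varepsilon}\right),\qquad n\to\infty.$$ (2) Assume each $\xi_i$ takes the values $0$ or $1$ each with equal probability. Then $$\mathbb{E}\left[C_{\mathbb{Q}_p}(f)\right]=\frac{3p-1}{2(p+1)}+O\left(n^{-1/4+\varepsilon}\right),\qquad n\to\infty.$$ (3) Assume each $\xi_i$ takes values in $\{0,\dots,p-1\}$ uniformly. Then $$\mathbb{E}\left[C_{\mathbb{Q}_p}(f)\right]=\frac{p^2+1}{p(p+1)}+O\left(n^{-1/4+\varepsilon}\right),\qquad n\to\infty.$$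
   Context: $\mathbb{Q}_p$ is the field of $p$-adic numbers and $\mathbb{Z}_p$ its ring of integers. $C_{\mathbb{Q}_p}(f)=\#\{x\in\mathbb{Q}_p: f(x)=0\}$ is the number of roots of $f$ in $\mathbb{Q}_p$, counted without multiplicities. The implied constants may depend on $p$ and $\varepsilon$. *)

theory Defs
  imports "HOL-Probability.Probability" "HOL-Computational_Algebra.Computational_Algebra"
    "HOL-Library.Landau_Symbols" "HOL-Algebra.QuotRing"
begin

section \<open>The field of p-adic numbers\<close>

text \<open>\<open>\<rat>\<^sub>p\<close> is the completion of \<open>\<rat>\<close> for the p-adic absolute value: the ring of p-adic Cauchy
  sequences of rationals modulo the ideal of p-adic null sequences.\<close>

definition padic_norm :: "nat \<Rightarrow> rat \<Rightarrow> real" where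
  "padic_norm p x = (if x = 0 then 0 else
     real p powi (int (multiplicity (int p) (snd (quotient_of x)))
                  - int (multiplicity (int p) (fst (quotient_of x)))))"

definition padic_Cauchy :: "nat \<Rightarrow> (nat \<Rightarrow> rat) \<Rightarrow> bool" where
  "padic_Cauchy p X \<longleftrightarrow> (\<forall>e>0. \<exists>N. \<forall>m\<ge>N. \<forall>n\<ge>N. padic_norm p (X m - X n) < e)"

definition padic_Cauchy_ring :: "nat \<Rightarrow> (nat \<Rightarrow> rat) ring" where
  "padic_Cauchy_ring p =
     \<lparr>carrier = {X. padic_Cauchy p X}, mult = (\<lambda>X Y n. X n * Y n), one = (\<lambda>n. 1),
      zero = (\<lambda>n. 0), add = (\<lambda>X Y n. X n + Y n)\<rparr>"

definition padic_null :: "nat \<Rightarrow> (nat \<Rightarrow> rat) set" where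
  "padic_null p = {X. (\<lambda>n. padic_norm p (X n)) \<longlonglongrightarrow> 0}"

definition padic_field :: "nat \<Rightarrow> (nat \<Rightarrow> rat) set ring" where
  "padic_field p = padic_Cauchy_ring p Quot padic_null p"


section \<open>Roots of integer polynomials in a ring\<close>

definition eval_int_poly :: "('a, 'b) ring_scheme \<Rightarrow> int poly \<Rightarrow> 'a \<Rightarrow> 'a" where
  "eval_int_poly R f x =
     (\<Oplus>\<^bsub>R\<^esub>i\<in>{..degree f}. ([coeff f i] \<cdot>\<^bsub>R\<^esub> \<one>\<^bsub>R\<^esub>) \<otimes>\<^bsub>R\<^esub> (x [^]\<^bsub>R\<^esub> i))"

text \<open>As \<^const>\<open>card\<close> is 0 on infinite sets, this is only meaningful when there are finitely many
  roots; the polynomials considered below are monic, hence nonzero.\<close>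

definition num_roots :: "('a, 'b) ring_scheme \<Rightarrow> int poly \<Rightarrow> nat" where
  "num_roots R f = card {x \<in> carrier R. eval_int_poly R f x = \<zero>\<^bsub>R\<^esub>}"


section \<open>Random monic polynomials\<close>

definition monic_poly :: "nat \<Rightarrow> (nat \<Rightarrow> int) \<Rightarrow> int poly" where
  "monic_poly n c = (\<Sum>i<n. monom (c i) i) + monom 1 n"

definition iid_uniform :: "'a measure \<Rightarrow> nat \<Rightarrow> (nat \<Rightarrow> 'a \<Rightarrow> int) \<Rightarrow> int set \<Rightarrow> bool" where
  "iid_uniform M n \<xi> S \<longleftrightarrow> prob_space M \<and>
     prob_space.indep_vars M (\<lambda>_. count_space UNIV) \<xi> {..<n} \<and>
     (\<forall>i<n. distr M (count_space UNIV) (\<xi> i) = measure_pmf (pmf_of_set S))"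

definition expected_roots :: "nat \<Rightarrow> 'a measure \<Rightarrow> nat \<Rightarrow> (nat \<Rightarrow> 'a \<Rightarrow> int) \<Rightarrow> real" where
  "expected_roots p M n \<xi> =
     (\<integral>\<omega>. real (num_roots (padic_field p) (monic_poly n (\<lambda>i. \<xi> i \<omega>))) \<partial>M)"


section \<open>The p-adic numbers form a field\<close>

lemma padic_norm_of_int_div:
  assumes "prime p" "a \<noteq> 0" "b \<noteq> 0"
  shows "padic_norm p (of_int a / of_int b) =
    real p powi (int (multiplicity (int p) b) - int (multiplicity (int p) a))"
proof -
  obtain c d where cd: "quotient_of (of_int a / of_int b) = (c, d)" by fastforce
  have d: "d > 0" using quotient_of_denom_pos[OF cd] .
  have "(of_int a / of_int b :: rat) = of_int c / of_int d" using quotient_of_div[OF cd] .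
  hence "(of_int (a * d) :: rat) = of_int (c * b)"
    using assms d by (simp add: field_simps)
  hence eq: "a * d = c * b" by (simp only: of_int_eq_iff)
  have c: "c \<noteq> 0" using eq assms d by auto
  have pp: "prime_elem (int p)" using assms(1) by simp
  have "multiplicity (int p) a + multiplicity (int p) d
      = multiplicity (int p) c + multiplicity (int p) b"
    using prime_elem_multiplicity_mult_distrib[OF pp, of a d]
      prime_elem_multiplicity_mult_distrib[OF pp, of c b] eq assms c d by simp
  hence exps: "int (multiplicity (int p) d) - int (multiplicity (int p) c)
      = int (multiplicity (int p) b) - int (multiplicity (int p) a)" by linarith
  show ?thesis using assms cd by (simp add: padic_norm_def exps)
qed

lemma padic_norm_0 [simp]: "padic_norm p 0 = 0"
  by (simp add: padic_norm_def)

lemma padic_norm_1 [simp]: "prime p \<Longrightarrow> padic_norm p 1 = 1"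
  using padic_norm_of_int_div[of p 1 1] by simp

lemma padic_norm_nonneg [simp]: "0 \<le> padic_norm p x"
  by (simp add: padic_norm_def)

lemma padic_norm_pos: "prime p \<Longrightarrow> x \<noteq> 0 \<Longrightarrow> 0 < padic_norm p x"
  by (simp add: padic_norm_def prime_gt_0_nat)

lemma rat_common_denominator:
  fixes x y :: rat
  obtains a b d :: int where "d \<noteq> 0" "x = (of_int a / of_int d :: rat)" "y = of_int b / of_int d"
proof -
  obtain a d where x: "quotient_of x = (a, d)" by fastforce
  obtain b e where y: "quotient_of y = (b, e)" by fastforce
  have d: "d > 0" "e > 0" using quotient_of_denom_pos[OF x] quotient_of_denom_pos[OF y] by auto
  have "x = of_int (a * e) / of_int (d * e)" "y = of_int (b * d) / of_int (d * e)"
    using quotient_of_div[OF x] quotient_of_div[OF y] d by (auto simp: field_simps)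
  then show ?thesis using d that[of "d * e" "a * e" "b * d"] by auto
qed

lemma padic_norm_mult:
  assumes p: "prime p"
  shows "padic_norm p (x * y) = padic_norm p x * padic_norm p y"
proof (cases "x = 0 \<or> y = 0")
  case False
  obtain a b d where abd: "d \<noteq> 0" "x = of_int a / of_int d" "y = of_int b / of_int d"
    by (rule rat_common_denominator)
  have nz: "a \<noteq> 0" "b \<noteq> 0" using False abd by auto
  have pp: "prime_elem (int p)" using p by simp
  have xy: "x * y = of_int (a * b) / of_int (d * d)" using abd by simp
  have p0: "real p \<noteq> 0" using p prime_gt_0_nat by auto
  show ?thesis
    unfolding xy using abd nz p p0
    by (simp add: padic_norm_of_int_div prime_elem_multiplicity_mult_distrib[OF pp]
          del: of_int_mult flip: power_int_add) (simp add: algebra_simps)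
qed auto

lemma padic_norm_minus: "prime p \<Longrightarrow> padic_norm p (- x) = padic_norm p x"
proof -
  assume p: "prime p"
  have "padic_norm p (-1) = 1" using padic_norm_of_int_div[OF p, of "-1" 1] by simp
  then show ?thesis using padic_norm_mult[OF p, of "-1" x] by simp
qed

lemma padic_norm_minus_commute: "prime p \<Longrightarrow> padic_norm p (x - y) = padic_norm p (y - x)"
  using padic_norm_minus[of p "x - y"] by simp

lemma padic_norm_inverse: "prime p \<Longrightarrow> padic_norm p (inverse x) = inverse (padic_norm p x)"
  using padic_norm_mult[of p x "inverse x"] padic_norm_pos[of p x]
  by (cases "x = 0") (auto simp: field_simps)

lemma padic_norm_add:
  assumes p: "prime p"
  shows "padic_norm p (x + y) \<le> max (padic_norm p x) (padic_norm p y)"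
proof (cases "x = 0 \<or> y = 0 \<or> x + y = 0")
  case True
  then show ?thesis by (auto simp: le_max_iff_disj)
next
  case False
  obtain a b d where abd: "d \<noteq> 0" "x = of_int a / of_int d" "y = of_int b / of_int d"
    by (rule rat_common_denominator)
  have nz: "a \<noteq> 0" "b \<noteq> 0" using False abd by auto
  have xy: "x + y = of_int (a + b) / of_int d" using abd by (simp add: add_divide_distrib)
  have nz': "a + b \<noteq> 0" using False xy by auto
  have nu: "\<not> is_unit (int p)" using prime_gt_1_nat[OF p] by simp
  let ?m = "multiplicity (int p)"
  have "int p ^ min (?m a) (?m b) dvd a + b"
    by (intro dvd_add) (auto intro: multiplicity_dvd')
  hence "min (?m a) (?m b) \<le> ?m (a + b)"
    using nz' nu by (intro multiplicity_geI) auto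
  hence le: "?m a \<le> ?m (a + b) \<or> ?m b \<le> ?m (a + b)" by auto
  have p1: "1 \<le> real p" using prime_ge_1_nat[OF p] by simp
  have "real p powi (int (?m d) - int (?m (a + b))) \<le> real p powi (int (?m d) - int (?m c))"
    if "?m c \<le> ?m (a + b)" for c
    using that p1 by (intro power_int_increasing) auto
  then show ?thesis
    unfolding xy unfolding abd(2,3) padic_norm_of_int_div[OF p nz' abd(1)]
      padic_norm_of_int_div[OF p nz(1) abd(1)] padic_norm_of_int_div[OF p nz(2) abd(1)]
    using le by (auto simp: le_max_iff_disj)
qed

lemma padic_norm_add_less:
  "prime p \<Longrightarrow> padic_norm p x < e \<Longrightarrow> padic_norm p y < e \<Longrightarrow> padic_norm p (x + y) < e"
  using padic_norm_add[of p x y] by linarith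

lemma padic_null_iff:
  "X \<in> padic_null p \<longleftrightarrow> (\<forall>e>0. \<exists>N. \<forall>n\<ge>N. padic_norm p (X n) < e)"
  by (simp add: padic_null_def LIMSEQ_def)

lemma padic_Cauchy_bounded:
  assumes p: "prime p" and X: "padic_Cauchy p X"
  obtains B where "B > 0" "\<And>n. padic_norm p (X n) \<le> B"
proof -
  obtain N where N: "\<And>m n. m \<ge> N \<Longrightarrow> n \<ge> N \<Longrightarrow> padic_norm p (X m - X n) < 1"
    using X unfolding padic_Cauchy_def by (meson zero_less_one)
  define B where "B = 1 + (\<Sum>i\<le>N. padic_norm p (X i))"
  have small: "padic_norm p (X n) \<le> B - 1" if "n \<le> N" for n
    unfolding B_def using that member_le_sum[of n "{..N}" "\<lambda>i. padic_norm p (X i)"] by auto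
  have B: "B > 0" unfolding B_def by (simp add: add_pos_nonneg sum_nonneg)
  have "padic_norm p (X n) \<le> B" for n
  proof (cases "n \<le> N")
    case False
    have "padic_norm p (X n) \<le> max (padic_norm p (X n - X N)) (padic_norm p (X N))"
      using padic_norm_add[OF p, of "X n - X N" "X N"] by simp
    then show ?thesis
      using N[of n N] False small[of N] padic_norm_nonneg[of p "X N"] by linarith
  qed (use small in force)
  then show ?thesis using B that by blast
qed

lemma padic_Cauchy_const [simp]: "padic_Cauchy p (\<lambda>n. c)"
  by (auto simp: padic_Cauchy_def)

lemma padic_Cauchy_add:
  assumes p: "prime p" and "padic_Cauchy p X" "padic_Cauchy p Y"
  shows "padic_Cauchy p (\<lambda>n. X n + Y n)"
  unfolding padic_Cauchy_def
proof (intro allI impI)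
  fix e :: real assume e: "e > 0"
  obtain N1 N2 where N: "\<And>m n. m \<ge> N1 \<Longrightarrow> n \<ge> N1 \<Longrightarrow> padic_norm p (X m - X n) < e"
      "\<And>m n. m \<ge> N2 \<Longrightarrow> n \<ge> N2 \<Longrightarrow> padic_norm p (Y m - Y n) < e"
    using assms e unfolding padic_Cauchy_def by meson
  have "padic_norm p (X m + Y m - (X n + Y n)) < e" if "m \<ge> max N1 N2" "n \<ge> max N1 N2" for m n
    using padic_norm_add_less[OF p N(1) N(2), of m n m n] that by (simp add: algebra_simps)
  then show "\<exists>N. \<forall>m\<ge>N. \<forall>n\<ge>N. padic_norm p (X m + Y m - (X n + Y n)) < e" by blast
qed

lemma padic_Cauchy_mult:
  assumes p: "prime p" and X: "padic_Cauchy p X" and Y: "padic_Cauchy p Y"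
  shows "padic_Cauchy p (\<lambda>n. X n * Y n)"
  unfolding padic_Cauchy_def
proof (intro allI impI)
  fix e :: real assume e: "e > 0"
  obtain A where A: "A > 0" "\<And>n. padic_norm p (X n) \<le> A"
    using padic_Cauchy_bounded[OF p X] by blast
  obtain B where B: "B > 0" "\<And>n. padic_norm p (Y n) \<le> B"
    using padic_Cauchy_bounded[OF p Y] by blast
  have eA: "e / A > 0" "e / B > 0" using e A B by auto
  obtain N1 where N1: "\<And>m n. m \<ge> N1 \<Longrightarrow> n \<ge> N1 \<Longrightarrow> padic_norm p (X m - X n) < e / B"
    using X eA unfolding padic_Cauchy_def by meson
  obtain N2 where N2: "\<And>m n. m \<ge> N2 \<Longrightarrow> n \<ge> N2 \<Longrightarrow> padic_norm p (Y m - Y n) < e / A"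
    using Y eA unfolding padic_Cauchy_def by meson
  have "padic_norm p (X m * Y m - X n * Y n) < e" if mn: "m \<ge> max N1 N2" "n \<ge> max N1 N2" for m n
  proof -
    have "padic_norm p ((X m - X n) * Y m) < e"
    proof -
      have "padic_norm p (X m - X n) * padic_norm p (Y m) \<le> padic_norm p (X m - X n) * B"
        by (intro mult_left_mono B) auto
      also have "\<dots> < e" using N1[of m n] mn B(1) by (simp add: pos_less_divide_eq)
      finally show ?thesis by (simp add: padic_norm_mult[OF p])
    qed
    moreover have "padic_norm p ((Y m - Y n) * X n) < e"
    proof -
      have "padic_norm p (Y m - Y n) * padic_norm p (X n) \<le> padic_norm p (Y m - Y n) * A"
        by (intro mult_left_mono A) auto
      also have "\<dots> < e" using N2[of m n] mn A(1) by (simp add: pos_less_divide_eq)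
      finally show ?thesis by (simp add: padic_norm_mult[OF p])
    qed
    ultimately have "padic_norm p ((X m - X n) * Y m + (Y m - Y n) * X n) < e"
      by (rule padic_norm_add_less[OF p])
    then show ?thesis by (simp add: algebra_simps)
  qed
  then show "\<exists>N. \<forall>m\<ge>N. \<forall>n\<ge>N. padic_norm p (X m * Y m - X n * Y n) < e" by blast
qed

lemma padic_Cauchy_minus: "prime p \<Longrightarrow> padic_Cauchy p X \<Longrightarrow> padic_Cauchy p (\<lambda>n. - X n)"
  using padic_Cauchy_mult[of p "\<lambda>_. -1" X] by simp

lemma padic_Cauchy_ring_simps [simp]:
  "carrier (padic_Cauchy_ring p) = {X. padic_Cauchy p X}"
  "X \<otimes>\<^bsub>padic_Cauchy_ring p\<^esub> Y = (\<lambda>n. X n * Y n)"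
  "X \<oplus>\<^bsub>padic_Cauchy_ring p\<^esub> Y = (\<lambda>n. X n + Y n)"
  "\<one>\<^bsub>padic_Cauchy_ring p\<^esub> = (\<lambda>n. 1)"
  "\<zero>\<^bsub>padic_Cauchy_ring p\<^esub> = (\<lambda>n. 0)"
  by (simp_all add: padic_Cauchy_ring_def)

lemma padic_Cauchy_ring_cring:
  assumes p: "prime p"
  shows "cring (padic_Cauchy_ring p)"
proof (rule cringI)
  show "abelian_group (padic_Cauchy_ring p)"
  proof (rule abelian_groupI)
    fix X assume "X \<in> carrier (padic_Cauchy_ring p)"
    then show "\<exists>Y\<in>carrier (padic_Cauchy_ring p).
        Y \<oplus>\<^bsub>padic_Cauchy_ring p\<^esub> X = \<zero>\<^bsub>padic_Cauchy_ring p\<^esub>"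
      using padic_Cauchy_minus[OF p] by (intro bexI[of _ "\<lambda>n. - X n"]) auto
  qed (auto simp: padic_Cauchy_add[OF p] algebra_simps)
  show "comm_monoid (padic_Cauchy_ring p)"
    by (rule comm_monoidI) (auto simp: padic_Cauchy_mult[OF p] algebra_simps)
qed (auto simp: algebra_simps)

lemma padic_null_Cauchy:
  assumes p: "prime p" and X: "X \<in> padic_null p"
  shows "padic_Cauchy p X"
  unfolding padic_Cauchy_def
proof (intro allI impI)
  fix e :: real assume e: "e > 0"
  obtain N where N: "\<And>n. n \<ge> N \<Longrightarrow> padic_norm p (X n) < e"
    using X e unfolding padic_null_iff by blast
  have "padic_norm p (X m - X n) < e" if "m \<ge> N" "n \<ge> N" for m n
    using padic_norm_add_less[OF p, of "X m" e "- X n"] N that by (simp add: padic_norm_minus[OF p])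
  then show "\<exists>N. \<forall>m\<ge>N. \<forall>n\<ge>N. padic_norm p (X m - X n) < e" by blast
qed

lemma padic_null_mult:
  assumes p: "prime p" and X: "X \<in> padic_null p" and Y: "padic_Cauchy p Y"
  shows "(\<lambda>n. Y n * X n) \<in> padic_null p"
  unfolding padic_null_iff
proof (intro allI impI)
  fix e :: real assume e: "e > 0"
  obtain B where B: "B > 0" "\<And>n. padic_norm p (Y n) \<le> B"
    using padic_Cauchy_bounded[OF p Y] by blast
  have "e / B > 0" using e B by simp
  then obtain N where N: "\<And>n. n \<ge> N \<Longrightarrow> padic_norm p (X n) < e / B"
    using X unfolding padic_null_iff by blast
  have "padic_norm p (Y n * X n) < e" if "n \<ge> N" for n
  proof -
    have "padic_norm p (Y n * X n) \<le> B * padic_norm p (X n)"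
      unfolding padic_norm_mult[OF p] by (intro mult_right_mono B) auto
    also have "\<dots> < e" using N[OF that] B(1) by (simp add: pos_less_divide_eq mult.commute)
    finally show ?thesis .
  qed
  then show "\<exists>N. \<forall>n\<ge>N. padic_norm p (Y n * X n) < e" by blast
qed

lemma padic_null_ideal:
  assumes p: "prime p"
  shows "ideal (padic_null p) (padic_Cauchy_ring p)"
proof -
  interpret R: cring "padic_Cauchy_ring p" by (rule padic_Cauchy_ring_cring[OF p])
  have minus: "\<ominus>\<^bsub>padic_Cauchy_ring p\<^esub> X = (\<lambda>n. - X n)" if "padic_Cauchy p X" for X
    using that padic_Cauchy_minus[OF p that] by (intro R.minus_equality) auto
  have add: "(\<lambda>n. X n + Y n) \<in> padic_null p" if X: "X \<in> padic_null p" and Y: "Y \<in> padic_null p" for X Y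
    unfolding padic_null_iff
  proof (intro allI impI)
    fix e :: real assume e: "e > 0"
    obtain N1 N2 where N: "\<And>n. n \<ge> N1 \<Longrightarrow> padic_norm p (X n) < e"
        "\<And>n. n \<ge> N2 \<Longrightarrow> padic_norm p (Y n) < e"
      using X Y e unfolding padic_null_iff by meson
    then show "\<exists>N. \<forall>n\<ge>N. padic_norm p (X n + Y n) < e"
      by (intro exI[of _ "max N1 N2"]) (auto intro: padic_norm_add_less[OF p])
  qed
  show ?thesis
  proof (rule idealI)
    show "ring (padic_Cauchy_ring p)" by (rule R.ring_axioms)
    show "subgroup (padic_null p) (add_monoid (padic_Cauchy_ring p))"
    proof
      fix X assume X: "X \<in> padic_null p"
      have "inv\<^bsub>add_monoid (padic_Cauchy_ring p)\<^esub> X = (\<lambda>n. - X n)"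
        using minus[OF padic_null_Cauchy[OF p X]] by (simp add: a_inv_def)
      then show "inv\<^bsub>add_monoid (padic_Cauchy_ring p)\<^esub> X \<in> padic_null p"
        using X by (simp add: padic_null_def padic_norm_minus[OF p])
    qed (auto simp: padic_null_Cauchy[OF p] add, simp add: padic_null_def)
  qed (use padic_null_mult[OF p] in \<open>auto simp: mult.commute\<close>)
qed

lemma padic_Cauchy_not_null:
  assumes p: "prime p" and X: "padic_Cauchy p X" and nX: "X \<notin> padic_null p"
  obtains d N where "d > 0" "\<And>n. n \<ge> N \<Longrightarrow> padic_norm p (X n) \<ge> d"
proof -
  obtain d where d: "d > 0" "\<And>N. \<exists>n\<ge>N. padic_norm p (X n) \<ge> d"
    using nX unfolding padic_null_iff by (meson not_le)
  obtain N where N: "\<And>m n. m \<ge> N \<Longrightarrow> n \<ge> N \<Longrightarrow> padic_norm p (X m - X n) < d"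
    using X d unfolding padic_Cauchy_def by meson
  obtain k where k: "k \<ge> N" "padic_norm p (X k) \<ge> d" using d(2) by blast
  have "padic_norm p (X n) \<ge> d" if "n \<ge> N" for n
    using padic_norm_add_less[OF p N[OF k(1) that], of "X n"] k(2) by force
  then show ?thesis using d that by blast
qed

lemma padic_Cauchy_not_null_inverse:
  assumes p: "prime p" and X: "padic_Cauchy p X" and nX: "X \<notin> padic_null p"
  obtains Y where "padic_Cauchy p Y" "(\<lambda>n. 1 - Y n * X n) \<in> padic_null p"
proof -
  obtain d M where d: "d > 0" "\<And>n. n \<ge> M \<Longrightarrow> padic_norm p (X n) \<ge> d"
    using padic_Cauchy_not_null[OF assms] by blast
  have nz: "X n \<noteq> 0" if "n \<ge> M" for n using d that by force
  define Y where "Y n = inverse (X n)" for n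
  have "padic_Cauchy p Y"
    unfolding padic_Cauchy_def
  proof (intro allI impI)
    fix e :: real assume e: "e > 0"
    have "e * (d * d) > 0" using e d by simp
    then obtain N where N: "\<And>m n. m \<ge> N \<Longrightarrow> n \<ge> N \<Longrightarrow> padic_norm p (X m - X n) < e * (d * d)"
      using X unfolding padic_Cauchy_def by meson
    have "padic_norm p (Y m - Y n) < e" if mn: "m \<ge> max M N" "n \<ge> max M N" for m n
    proof -
      have YY: "Y m - Y n = (X n - X m) * inverse (X m * X n)"
        using nz mn by (simp add: Y_def field_simps)
      have eq: "padic_norm p (Y m - Y n)
          = padic_norm p (X n - X m) / (padic_norm p (X m) * padic_norm p (X n))"
        unfolding YY padic_norm_mult[OF p] padic_norm_inverse[OF p] divide_inverse ..
      have "d * d \<le> padic_norm p (X m) * padic_norm p (X n)"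
        using d mn by (intro mult_mono) auto
      hence "e * (d * d) \<le> e * (padic_norm p (X m) * padic_norm p (X n))"
        using e by (intro mult_left_mono) auto
      moreover have "padic_norm p (X n - X m) < e * (d * d)" using N mn by simp
      moreover have "padic_norm p (X m) * padic_norm p (X n) > 0"
        using nz mn padic_norm_pos[OF p] by simp
      ultimately show ?thesis unfolding eq
        by (subst pos_divide_less_eq) linarith+
    qed
    then show "\<exists>N. \<forall>m\<ge>N. \<forall>n\<ge>N. padic_norm p (Y m - Y n) < e" by blast
  qed
  moreover have "(\<lambda>n. 1 - Y n * X n) \<in> padic_null p"
    unfolding padic_null_iff using nz by (auto simp: Y_def intro!: exI[of _ M])
  ultimately show ?thesis using that by blast
qed

theorem padic_field_field:
  assumes p: "prime p"
  shows "field (padic_field p)"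
proof -
  let ?R = "padic_Cauchy_ring p"
  have "maximalideal (padic_null p) ?R"
  proof (rule maximalidealI)
    show "ideal (padic_null p) ?R" by (rule padic_null_ideal[OF p])
    have "(\<lambda>n. 1) \<notin> padic_null p"
    proof
      assume "(\<lambda>n. 1) \<in> padic_null p"
      hence "(\<lambda>n. 1 :: real) \<longlonglongrightarrow> 0" using p by (simp add: padic_null_def)
      from LIMSEQ_unique[OF this tendsto_const] show False by simp
    qed
    then show "carrier ?R \<noteq> padic_null p" by auto
  next
    fix J assume J: "ideal J ?R" "padic_null p \<subseteq> J" "J \<subseteq> carrier ?R"
    interpret J: ideal J ?R by (rule J)
    show "J = padic_null p \<or> J = carrier ?R"
    proof (cases "J = padic_null p")
      case False
      then obtain X where X: "X \<in> J" "X \<notin> padic_null p" using J by blast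
      then obtain Y where Y: "padic_Cauchy p Y" "(\<lambda>n. 1 - Y n * X n) \<in> padic_null p"
        using padic_Cauchy_not_null_inverse[OF p, of X] J by auto
      have "(\<lambda>n. Y n * X n) \<in> J" using J.I_l_closed[OF X(1), of Y] Y by simp
      moreover have "(\<lambda>n. 1 - Y n * X n) \<in> J" using Y J by blast
      ultimately have "(\<lambda>n. (1 - Y n * X n) + Y n * X n) \<in> J"
        using additive_subgroup.a_closed[OF J.additive_subgroup_axioms, of "\<lambda>n. 1 - Y n * X n" "\<lambda>n. Y n * X n"] by simp
      hence "\<one>\<^bsub>?R\<^esub> \<in> J" by simp
      then show ?thesis using J.one_imp_carrier by blast
    qed simp
  qed
  then show ?thesis
    unfolding padic_field_def
    by (rule maximalideal.quotient_is_field[OF _ padic_Cauchy_ring_cring[OF p]])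
qed

end

theory Submission
  imports Defs "HOL-Number_Theory.Cong" "HOL-Real_Asymp.Real_Asymp"
begin

text \<open>
  Write \<open>f'\<close> for the derivative of \<open>f\<close> and count separately the roots in \<open>p\<int>\<^sub>p\<close> and the unit roots. A
  nonzero coefficient of \<open>f\<close> is a p-adic unit, so \<open>f\<close> is a power of \<open>X\<close> times a polynomial with unit
  constant term; hence the only possible root in \<open>p\<int>\<^sub>p\<close> is \<open>0\<close>, and it occurs exactly when \<open>\<xi>\<^sub>0 = 0\<close>
  (\<open>nonunit_roots\<close>). This accounts for the terms \<open>0\<close>, \<open>1/2\<close> and \<open>1/p\<close> that distinguish the three cases.

  The unit roots contribute \<open>(p-1)/(p+1)\<close> in all cases. Fix a precision \<open>k\<close> and let \<open>r\<close> run over the units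
  modulo \<open>p\<^sup>k\<close>. If \<open>p\<^sup>v\<close> is the exact power dividing \<open>f'(r)\<close> and \<open>v < k\<close>, then by Hensel's lemma the class
  of \<open>r\<close> contains a root if and only if \<open>p\<close> to the power \<open>k + v\<close> divides \<open>f(r)\<close>, and the root is unique
  (\<open>card_simple_unit_roots\<close>). If the pair \<open>(f(r), f'(r))\<close> were uniformly distributed modulo a high power
  of \<open>p\<close>, the expected number of such roots would be a geometric series in \<open>p\<^sup>-\<^sup>2\<close>, which sums to
  \<open>(p-1)/(p+1)\<close> up to a factor \<open>1 - p\<^sup>-\<^sup>2\<^sup>k\<close> (\<open>main_term\<close>).

  Uniformity up to a small error holds because a nontrivial additive character modulo \<open>q = p\<^sup>2\<^sup>k\<close>, applied
  to a combination \<open>A f(r) + B f'(r)\<close>, factors over the independent coefficients. The weights of two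
  consecutive coefficients cannot both vanish modulo \<open>q\<close>, so at least every second factor has modulus at
  most \<open>1 - c/q\<^sup>2\<close> (\<open>equidistribution\<close>). The error is therefore smaller than every negative power of \<open>n\<close> as long
  as \<open>q\<^sup>2 \<le> n\<^sup>1\<^sup>-\<^sup>\<delta>\<close>, that is, for \<open>p\<^sup>k\<close> slightly below the fourth root of \<open>n\<close>.

  What remains are the roots near which \<open>f'\<close> vanishes modulo \<open>p\<^sup>k\<close>. Such a root exists with probability at most about
  \<open>p\<^sup>k p\<^sup>-\<^sup>2\<^sup>k = p\<^sup>-\<^sup>k\<close>, and this is the source of the exponent \<open>-1/4\<close>. Their number is at most
  the number of all unit roots, which is bounded by the sum over \<open>r\<close> of the multiplicities of the roots \<open>r\<close> of
  \<open>f\<close> modulo \<open>p\<close> (\<open>card_unit_roots_le\<close>). A multiplicity at least \<open>m\<close> prescribes the lowest \<open>m\<close> coefficients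
  modulo \<open>p\<close> in terms of the others, so its probability decays exponentially in \<open>m\<close>
  (\<open>mean_taylor_coeffs_dvd\<close>), and \<open>m\<close> may be taken as an arbitrarily small power of \<open>n\<close>.
\<close>

section \<open>Roots in the p-adic field as coherent sequences of residues\<close>

text \<open>A p-adic integer \<open>x\<close> is encoded by its least nonnegative residues \<open>a k\<close> modulo \<open>p\<^sup>k\<close>; taking the least
  residues makes the encoding injective. The last condition says \<open>f(x) = 0\<close>. In this form every question about
  roots becomes one about divisibility of integers.\<close>

definition residue_roots :: "nat \<Rightarrow> int poly \<Rightarrow> (nat \<Rightarrow> int) set" where
  "residue_roots p f = {a. \<forall>k. 0 \<le> a k \<and> a k < int p ^ k \<and>
      int p ^ k dvd a (Suc k) - a k \<and> int p ^ k dvd poly f (a k)}"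

definition rat_eval :: "int poly \<Rightarrow> rat \<Rightarrow> rat" where
  "rat_eval f x = (\<Sum>i\<le>degree f. of_int (coeff f i) * x ^ i)"

lemma rat_eval_of_int: "rat_eval f (of_int a) = of_int (poly f a)"
  by (simp add: rat_eval_def poly_altdef)

lemma ring_hom_eval_int_poly:
  assumes "ring_hom_cring R S h" "x \<in> carrier R"
  shows "eval_int_poly S f (h x) = h (eval_int_poly R f x)"
proof -
  interpret ring_hom_cring R S h by (rule assms)
  interpret G: group_hom "add_monoid R" "add_monoid S" h
    by unfold_locales (auto simp: hom_def)
  have pow: "h ([k] \<cdot>\<^bsub>R\<^esub> \<one>\<^bsub>R\<^esub>) = [k] \<cdot>\<^bsub>S\<^esub> \<one>\<^bsub>S\<^esub>" for k :: int
    using G.hom_int_pow[of "\<one>\<^bsub>R\<^esub>" k] by (simp add: add_pow_def)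
  have hpow: "h (x [^]\<^bsub>R\<^esub> i) = h x [^]\<^bsub>S\<^esub> i" for i :: nat
    by (induction i) (use assms(2) in auto)
  show ?thesis
    unfolding eval_int_poly_def using assms(2)
    by (simp add: pow hpow Pi_iff R.add.int_pow_closed)
qed

lemma padic_Cauchy_ring_eval:
  assumes p: "prime p" and X: "padic_Cauchy p X"
  shows "eval_int_poly (padic_Cauchy_ring p) f X = (\<lambda>n. rat_eval f (X n))"
proof -
  let ?R = "padic_Cauchy_ring p"
  interpret R: cring ?R by (rule padic_Cauchy_ring_cring[OF p])
  have pow: "Y [^]\<^bsub>?R\<^esub> i = (\<lambda>n. Y n ^ i)" for Y and i :: nat
    by (induction i) (simp_all add: mult.commute)
  have npow: "[k] \<cdot>\<^bsub>?R\<^esub> \<one>\<^bsub>?R\<^esub> = (\<lambda>n. of_nat k)" for k :: nat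
    by (induction k) (simp_all add: algebra_simps)
  have minus: "\<ominus>\<^bsub>?R\<^esub> Y = (\<lambda>n. - Y n)" if "padic_Cauchy p Y" for Y
    using that padic_Cauchy_minus[OF p that] by (intro R.minus_equality) auto
  have ipow: "[k] \<cdot>\<^bsub>?R\<^esub> \<one>\<^bsub>?R\<^esub> = (\<lambda>n. of_int k)" for k :: int
  proof (cases "k \<ge> 0")
    case True
    then show ?thesis by (simp add: add_pow_int_ge npow del: padic_Cauchy_ring_simps)
  next
    case False
    then show ?thesis
      by (simp add: add_pow_int_lt npow minus del: padic_Cauchy_ring_simps)
  qed
  have pc: "padic_Cauchy p (\<lambda>n. X n ^ i)" for i
    by (induction i) (auto intro: padic_Cauchy_mult[OF p X])
  have trm: "([c] \<cdot>\<^bsub>?R\<^esub> \<one>\<^bsub>?R\<^esub>) \<otimes>\<^bsub>?R\<^esub> (X [^]\<^bsub>?R\<^esub> i) = (\<lambda>n. of_int c * X n ^ i)" for c :: int and i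
    by (simp add: ipow pow del: padic_Cauchy_ring_simps(4))
  have tc: "padic_Cauchy p (\<lambda>n. of_int c * X n ^ i)" for c i
    using padic_Cauchy_mult[OF p _ pc, of "\<lambda>_. of_int c"] by simp
  have "finsum ?R (\<lambda>i n. of_int (g i) * X n ^ i) A = (\<lambda>n. \<Sum>i\<in>A. of_int (g i) * X n ^ i)"
    if "finite A" for A and g :: "nat \<Rightarrow> int"
    using that
  proof (induction A)
    case (insert x A)
    have "finsum ?R (\<lambda>i n. of_int (g i) * X n ^ i) (insert x A) = 
       (\<lambda>n. of_int (g x) * X n ^ x) \<oplus>\<^bsub>?R\<^esub> finsum ?R (\<lambda>i n. of_int (g i) * X n ^ i) A"
      by (rule R.finsum_insert) (use insert tc in auto)
    then show ?case using insert by simp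
  qed simp
  then show ?thesis
    unfolding eval_int_poly_def trm rat_eval_def by simp
qed

lemma padic_field_eval_zero_iff:
  assumes p: "prime p" and X: "padic_Cauchy p X"
  shows "eval_int_poly (padic_field p) f (padic_null p +>\<^bsub>padic_Cauchy_ring p\<^esub> X) = \<zero>\<^bsub>padic_field p\<^esub>
     \<longleftrightarrow> (\<lambda>n. rat_eval f (X n)) \<in> padic_null p"
    (is "?E = _ \<longleftrightarrow> ?F \<in> _")
proof -
  let ?R = "padic_Cauchy_ring p"
  interpret R: cring ?R by (rule padic_Cauchy_ring_cring[OF p])
  interpret I: ideal "padic_null p" ?R by (rule padic_null_ideal[OF p])
  have h: "ring_hom_cring ?R (padic_field p) ((+>\<^bsub>?R\<^esub>) (padic_null p))"
    unfolding padic_field_def by (rule I.rcos_ring_hom_cring) (rule R.cring_axioms)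
  have E: "?E = padic_null p +>\<^bsub>?R\<^esub> ?F"
    using ring_hom_eval_int_poly[OF h, of X f] X by (simp add: padic_Cauchy_ring_eval[OF p X])
  have "X \<in> carrier ?R" using X by simp
  then have "eval_int_poly ?R f X \<in> carrier ?R"
    unfolding eval_int_poly_def
    by (intro R.finsum_closed Pi_I R.m_closed R.nat_pow_closed R.add.int_pow_closed R.one_closed)
  then have c: "?F \<in> carrier ?R" by (simp only: padic_Cauchy_ring_eval[OF p X])
  have "\<zero>\<^bsub>padic_field p\<^esub> = padic_null p" by (simp add: padic_field_def FactRing_def)
  then show ?thesis unfolding E 
    using I.rcos_const_imp_mem[OF c] I.a_rcos_const by metis
qed

lemma padic_coset_eq_iff:
  assumes p: "prime p" and X: "padic_Cauchy p X" and Y: "padic_Cauchy p Y"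
  shows "padic_null p +>\<^bsub>padic_Cauchy_ring p\<^esub> X = padic_null p +>\<^bsub>padic_Cauchy_ring p\<^esub> Y
     \<longleftrightarrow> (\<lambda>n. X n - Y n) \<in> padic_null p"
proof -
  let ?R = "padic_Cauchy_ring p"
  interpret R: cring ?R by (rule padic_Cauchy_ring_cring[OF p])
  interpret I: ideal "padic_null p" ?R by (rule padic_null_ideal[OF p])
  have "\<ominus>\<^bsub>?R\<^esub> Y = (\<lambda>n. - Y n)"
    using padic_Cauchy_minus[OF p Y] Y by (intro R.minus_equality) auto
  then have "X \<ominus>\<^bsub>?R\<^esub> Y = (\<lambda>n. X n - Y n)" by (simp add: R.minus_eq)
  then show ?thesis
    using R.quotient_eq_iff_same_a_r_cos[OF I.ideal_axioms, of X Y] X Y by simp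
qed

lemma padic_norm_le_iff_int:
  assumes p: "prime p"
  shows "padic_norm p (of_int a) \<le> (1 / real p) ^ k \<longleftrightarrow> int p ^ k dvd a"
proof (cases "a = 0")
  case True
  then show ?thesis by simp
next
  case False
  have p1: "1 < real p" using prime_gt_1_nat[OF p] by simp
  have "padic_norm p (of_int a) = (1 / real p) ^ multiplicity (int p) a"
    using padic_norm_of_int_div[OF p False, of 1]
    by (simp add: power_int_minus power_one_over inverse_eq_divide)
  also have "\<dots> \<le> (1 / real p) ^ k \<longleftrightarrow> k \<le> multiplicity (int p) a"
    using p1 by (intro power_decreasing_iff) auto
  also have "\<dots> \<longleftrightarrow> int p ^ k dvd a"
    using False prime_gt_1_nat[OF p] by (simp add: power_dvd_iff_le_multiplicity)
  finally show ?thesis .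
qed

lemma padic_norm_of_int_le_1: "prime p \<Longrightarrow> padic_norm p (of_int a) \<le> 1"
  using padic_norm_le_iff_int[of p a 0] by simp

lemma padic_norm_power: "prime p \<Longrightarrow> padic_norm p (x ^ i) = padic_norm p x ^ i"
  by (induction i) (simp_all add: padic_norm_mult)

lemma padic_norm_sum_le:
  assumes "prime p" "B \<ge> 0" "\<And>i. i \<in> A \<Longrightarrow> padic_norm p (g i) \<le> B"
  shows "padic_norm p (sum g A) \<le> B"
  using assms(3)
proof (induction A rule: infinite_finite_induct)
  case (insert x A)
  then show ?case using padic_norm_add[OF assms(1), of "g x" "sum g A"] by fastforce
qed (use assms in auto)

lemma padic_norm_diff_le:
  "prime p \<Longrightarrow> padic_norm p x \<le> B \<Longrightarrow> padic_norm p y \<le> B \<Longrightarrow> padic_norm p (x - y) \<le> B"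
  using padic_norm_add[of p x "- y"] by (simp add: padic_norm_minus)

lemma rat_eval_diff_le:
  assumes p: "prime p" and x: "padic_norm p x \<le> 1" and y: "padic_norm p y \<le> 1"
  shows "padic_norm p (rat_eval f x - rat_eval f y) \<le> padic_norm p (x - y)"
proof -
  have pw: "padic_norm p (x ^ i - y ^ i) \<le> padic_norm p (x - y)" for i
  proof (induction i)
    case (Suc i)
    have eq: "x ^ Suc i - y ^ Suc i = x * (x ^ i - y ^ i) + (x - y) * y ^ i"
      by (simp add: algebra_simps)
    have "padic_norm p (x * (x ^ i - y ^ i)) \<le> padic_norm p (x - y)"
      using mult_mono[OF x Suc] by (simp add: padic_norm_mult[OF p])
    moreover have "padic_norm p ((x - y) * y ^ i) \<le> padic_norm p (x - y)"
      using power_le_one[OF _ y, of i]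
      by (simp add: padic_norm_mult[OF p] padic_norm_power[OF p] mult_left_le)
    ultimately show ?case
      unfolding eq using padic_norm_add[OF p] by (meson max.boundedI order_trans)
  qed simp
  have "rat_eval f x - rat_eval f y = (\<Sum>i\<le>degree f. of_int (coeff f i) * (x ^ i - y ^ i))"
    by (simp add: rat_eval_def sum_subtractf algebra_simps)
  moreover have "padic_norm p (of_int (coeff f i) * (x ^ i - y ^ i)) \<le> padic_norm p (x - y)" for i
    using mult_mono[OF padic_norm_of_int_le_1[OF p, of "coeff f i"] pw[of i]]
    by (simp add: padic_norm_mult[OF p])
  ultimately show ?thesis by (simp add: padic_norm_sum_le[OF p])
qed

text \<open>If \<open>x\<close> is not integral, the leading term of a monic polynomial has strictly larger norm than all other terms,
  so the value of the polynomial cannot be small.\<close>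

lemma padic_norm_root_le_1:
  assumes p: "prime p" and monic: "lead_coeff f = 1" and small: "padic_norm p (rat_eval f x) < 1"
  shows "padic_norm p x \<le> 1"
proof (rule ccontr)
  define d where "d = degree f"
  define r where "r = (\<Sum>i<d. of_int (coeff f i) * x ^ i)"
  assume "\<not> padic_norm p x \<le> 1"
  then have x1: "padic_norm p x > 1" by simp
  have ev: "rat_eval f x = x ^ d + r"
    using monic by (simp add: rat_eval_def r_def d_def lessThan_Suc_atMost[symmetric])
  have xd: "padic_norm p (x ^ d) \<ge> 1"
    using x1 by (simp add: padic_norm_power[OF p])
  show False
  proof (cases d)
    case 0
    then show False using ev small p by (simp add: r_def)
  next
    case (Suc e)
    have "padic_norm p (of_int (coeff f i) * x ^ i) \<le> padic_norm p x ^ e" if "i < d" for i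
    proof -
      have "padic_norm p x ^ i \<le> padic_norm p x ^ e"
        using that Suc x1 by (intro power_increasing) auto
      then show ?thesis
        using mult_mono[OF padic_norm_of_int_le_1[OF p, of "coeff f i"], of "padic_norm p x ^ i" "padic_norm p x ^ e"]
        by (simp add: padic_norm_mult[OF p] padic_norm_power[OF p])
    qed
    then have r: "padic_norm p r \<le> padic_norm p x ^ e"
      unfolding r_def using x1 by (intro padic_norm_sum_le[OF p]) auto
    have "padic_norm p x ^ e < padic_norm p x ^ d"
      using x1 Suc by simp
    then have "padic_norm p (- r) < padic_norm p (x ^ d)"
      using r by (simp add: padic_norm_minus[OF p] padic_norm_power[OF p])
    moreover have "padic_norm p (rat_eval f x) < padic_norm p (x ^ d)" using small xd by simp
    ultimately have "padic_norm p (rat_eval f x + - r) < padic_norm p (x ^ d)"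
      by (intro padic_norm_add_less[OF p])
    then show False by (simp add: ev)
  qed
qed

text \<open>A rational of norm at most 1 has a denominator prime to \<open>p\<close>, which can be inverted modulo \<open>p\<^sup>k\<close>.\<close>

lemma padic_integer_approx:
  assumes p: "prime p" and x: "padic_norm p x \<le> 1"
  obtains a where "0 \<le> a" "a < int p ^ k" "padic_norm p (x - of_int a) \<le> (1 / real p) ^ k"
proof -
  obtain c d where cd: "quotient_of x = (c, d)" by fastforce
  have d: "d > 0" using quotient_of_denom_pos[OF cd] .
  have cop: "coprime c d" using quotient_of_coprime[OF cd] .
  have xeq: "x = of_int c / of_int d" using quotient_of_div[OF cd] .
  have p1: "1 < real p" using prime_gt_1_nat[OF p] by simp
  have pd: "\<not> int p dvd d"
  proof
    assume pd: "int p dvd d"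
    then have pc: "\<not> int p dvd c"
      using coprime_common_divisor[OF cop, of "int p"] prime_gt_1_nat[OF p] by auto
    then have c0: "c \<noteq> 0" by auto
    have m: "multiplicity (int p) d > 0"
      using pd d prime_gt_1_nat[OF p] by (simp add: prime_multiplicity_gt_zero_iff p)
    have "padic_norm p x = real p powi int (multiplicity (int p) d)"
      unfolding xeq using padic_norm_of_int_div[OF p c0, of d] d pc
      by (simp add: not_dvd_imp_multiplicity_0)
    also have "\<dots> > 1" using m p1 by simp
    finally show False using x by simp
  qed
  then have "coprime (int p) d"
    using p by (simp add: prime_imp_coprime)
  then have "coprime d (int p ^ k)" by (simp add: coprime_commute)
  then obtain e where e: "[d * e = 1] (mod int p ^ k)"
    using coprime_iff_invertible_int by blast
  define a where "a = c * e mod int p ^ k"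
  have pk: "int p ^ k > 0" using prime_gt_0_nat[OF p] by simp
  have "[a * d = c * e * d] (mod int p ^ k)"
    by (simp add: a_def cong_def mod_mult_left_eq)
  also have "c * e * d = c * (d * e)" by simp
  also have "[c * (d * e) = c * 1] (mod int p ^ k)" by (intro cong_mult e) simp
  finally have "int p ^ k dvd c - a * d"
    by (simp add: cong_iff_dvd_diff dvd_diff_commute)
  then have "padic_norm p (of_int (c - a * d)) \<le> (1 / real p) ^ k"
    by (simp only: padic_norm_le_iff_int[OF p])
  moreover have "padic_norm p (of_int d) = 1"
    using padic_norm_of_int_div[OF p _ , of d 1] d pd by (simp add: not_dvd_imp_multiplicity_0)
  moreover have "(x - of_int a) * of_int d = of_int (c - a * d)"
    using d xeq by (simp add: field_simps)
  ultimately have "padic_norm p (x - of_int a) \<le> (1 / real p) ^ k"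
    using padic_norm_mult[OF p, of "x - of_int a" "of_int d"] by simp
  moreover have "0 \<le> a" "a < int p ^ k" using pk by (auto simp: a_def)
  ultimately show ?thesis using that by blast
qed

lemma p_power_small:
  assumes "prime p" "(e::real) > 0"
  obtains K where "(1 / real p) ^ K < e"
  using real_arch_pow_inv[of e "1 / real p"] assms prime_gt_1_nat[of p] that by auto

lemma residue_roots_mono:
  assumes a: "a \<in> residue_roots p f" and "k \<le> l"
  shows "int p ^ k dvd a l - a k"
  using assms(2)
proof (induction l rule: dec_induct)
  case (step l)
  have "int p ^ l dvd a (Suc l) - a l" using a by (simp add: residue_roots_def)
  then have "int p ^ k dvd a (Suc l) - a l" using step by (meson le_imp_power_dvd dvd_trans)
  from dvd_add[OF this step.IH] show ?case by simp
qed simp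

lemma residue_roots_D:
  assumes "a \<in> residue_roots p f"
  shows "0 \<le> a k" "a k < int p ^ k" "int p ^ k dvd poly f (a k)"
  using assms by (auto simp: residue_roots_def)

lemma residue_roots_eqI:
  assumes a: "a \<in> residue_roots p f" and b: "b \<in> residue_roots p f"
    and "int p ^ k dvd a k - b k"
  shows "a k = b k"
proof -
  have "a k mod int p ^ k = b k mod int p ^ k" using assms(3) by (simp add: mod_eq_dvd_iff)
  then show ?thesis using residue_roots_D[OF a, of k] residue_roots_D[OF b, of k] by simp
qed

text \<open>Sending a coherent sequence of residues, read as a Cauchy sequence of rationals, to its class is injective,
  since a null sequence of differences is eventually divisible by each power of \<open>p\<close>. It reaches every root, since
  roots of a monic polynomial are integral and so a representing Cauchy sequence can be rounded to integers.\<close>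

theorem num_roots_padic_field:
  assumes p: "prime p" and monic: "lead_coeff f = 1"
  shows "num_roots (padic_field p) f = card (residue_roots p f)"
proof -
  let ?R = "padic_Cauchy_ring p"
  define \<Phi> where "\<Phi> a = padic_null p +>\<^bsub>?R\<^esub> (\<lambda>k. of_int (a k) :: rat)" for a :: "nat \<Rightarrow> int"
  have p1: "1 < real p" using prime_gt_1_nat[OF p] by simp
  have C: "padic_Cauchy p (\<lambda>k. of_int (a k))" if a: "a \<in> residue_roots p f" for a
    unfolding padic_Cauchy_def
  proof (intro allI impI)
    fix e :: real assume "e > 0"
    then obtain K where K: "(1 / real p) ^ K < e" using p_power_small[OF p] by blast
    have "padic_norm p (of_int (a m) - of_int (a n)) < e" if "m \<ge> K" "n \<ge> K" for m n
    proof -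
      have "int p ^ K dvd (a m - a K) - (a n - a K)"
        using residue_roots_mono[OF a] that by (intro dvd_diff[of _ "a m - a K"])
      then have "padic_norm p (of_int (a m - a n)) \<le> (1 / real p) ^ K"
        by (subst padic_norm_le_iff_int[OF p]) simp
      then show ?thesis using K by simp
    qed
    then show "\<exists>N. \<forall>m\<ge>N. \<forall>n\<ge>N. padic_norm p (of_int (a m) - of_int (a n)) < e" by blast
  qed
  have inj: "inj_on \<Phi> (residue_roots p f)"
  proof (rule inj_onI)
    fix a b assume a: "a \<in> residue_roots p f" and b: "b \<in> residue_roots p f" and eq: "\<Phi> a = \<Phi> b"
    then have null: "(\<lambda>k. of_int (a k) - of_int (b k)) \<in> padic_null p"
      unfolding \<Phi>_def using padic_coset_eq_iff[OF p C[OF a] C[OF b]] by simp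
    show "a = b"
    proof
      fix k
      have "(1 / real p) ^ k > 0" using p1 by simp
      then obtain N where N: "\<And>n. n \<ge> N \<Longrightarrow> padic_norm p (of_int (a n) - of_int (b n)) < (1 / real p) ^ k"
        using null unfolding padic_null_iff by blast
      define n where "n = max N k"
      have "padic_norm p (of_int (a n - b n)) \<le> (1 / real p) ^ k"
        using N[of n] by (simp add: n_def)
      then have "int p ^ k dvd a n - b n" by (simp only: padic_norm_le_iff_int[OF p])
      moreover have "int p ^ k dvd a n - a k" "int p ^ k dvd b n - b k"
        using residue_roots_mono[OF a, of k n] residue_roots_mono[OF b, of k n] by (auto simp: n_def)
      ultimately have "int p ^ k dvd (a n - b n) - (a n - a k) + (b n - b k)"
    by (intro dvd_add[of _ "(a n - b n) - (a n - a k)"] dvd_diff[of _ "a n - b n"])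
      then show "a k = b k" by (intro residue_roots_eqI[OF a b]) simp
    qed
  qed
  have carr: "carrier (padic_field p) = {padic_null p +>\<^bsub>?R\<^esub> X |X. padic_Cauchy p X}"
    by (auto simp: padic_field_def FactRing_def A_RCOSETS_def')
  have img: "\<Phi> ` residue_roots p f = {x \<in> carrier (padic_field p). eval_int_poly (padic_field p) f x = \<zero>\<^bsub>padic_field p\<^esub>}"
  proof (intro equalityI subsetI)
    fix x assume "x \<in> \<Phi> ` residue_roots p f"
    then obtain a where a: "a \<in> residue_roots p f" and x: "x = \<Phi> a" by blast
    have "(\<lambda>k. rat_eval f (of_int (a k))) \<in> padic_null p"
      unfolding padic_null_iff
    proof (intro allI impI)
      fix e :: real assume "e > 0"
      then obtain K where K: "(1 / real p) ^ K < e" using p_power_small[OF p] by blast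
      have "padic_norm p (rat_eval f (of_int (a n))) < e" if "n \<ge> K" for n
      proof -
        have "int p ^ K dvd poly f (a n)"
          using residue_roots_D(3)[OF a, of n] that by (meson le_imp_power_dvd dvd_trans)
        then show ?thesis
          using K unfolding rat_eval_of_int padic_norm_le_iff_int[OF p, symmetric] by simp
      qed
      then show "\<exists>N. \<forall>n\<ge>N. padic_norm p (rat_eval f (of_int (a n))) < e" by blast
    qed
    then show "x \<in> {x \<in> carrier (padic_field p). eval_int_poly (padic_field p) f x = \<zero>\<^bsub>padic_field p\<^esub>}"
      using C[OF a] by (auto simp: x \<Phi>_def carr padic_field_eval_zero_iff[OF p])
  next
    fix x assume "x \<in> {x \<in> carrier (padic_field p). eval_int_poly (padic_field p) f x = \<zero>\<^bsub>padic_field p\<^esub>}"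
    then obtain X where X: "padic_Cauchy p X" and x: "x = padic_null p +>\<^bsub>?R\<^esub> X"
      and null: "(\<lambda>n. rat_eval f (X n)) \<in> padic_null p"
      by (auto simp: carr padic_field_eval_zero_iff[OF p])
    have "\<exists>N. \<forall>n\<ge>N. padic_norm p (X n) \<le> 1"
      using null padic_norm_root_le_1[OF p monic] unfolding padic_null_iff by (meson zero_less_one)
    then obtain N0 where N0: "\<And>n. n \<ge> N0 \<Longrightarrow> padic_norm p (X n) \<le> 1" by blast
    have "\<exists>N. N \<ge> N0 \<and> (\<forall>m\<ge>N. \<forall>n\<ge>N. padic_norm p (X m - X n) \<le> (1 / real p) ^ k \<and>
         padic_norm p (rat_eval f (X n)) \<le> (1 / real p) ^ k)" for k
    proof -
      have pos: "(1 / real p) ^ k > 0" using p1 by simp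
      obtain N1 where N1: "\<And>m n. m \<ge> N1 \<Longrightarrow> n \<ge> N1 \<Longrightarrow> padic_norm p (X m - X n) < (1 / real p) ^ k"
        using X pos unfolding padic_Cauchy_def by meson
      obtain N2 where N2: "\<And>n. n \<ge> N2 \<Longrightarrow> padic_norm p (rat_eval f (X n)) < (1 / real p) ^ k"
        using null pos unfolding padic_null_iff by meson
      show ?thesis
        by (intro exI[of _ "max N0 (max N1 N2)"] conjI allI impI less_imp_le[OF N1] less_imp_le[OF N2]) auto
    qed
    then obtain N where N: "\<And>k. N k \<ge> N0"
      "\<And>k m n. m \<ge> N k \<Longrightarrow> n \<ge> N k \<Longrightarrow> padic_norm p (X m - X n) \<le> (1 / real p) ^ k"
      "\<And>k n. n \<ge> N k \<Longrightarrow> padic_norm p (rat_eval f (X n)) \<le> (1 / real p) ^ k"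
      by metis
    have "\<exists>a. 0 \<le> a \<and> a < int p ^ k \<and> padic_norm p (X (N k) - of_int a) \<le> (1 / real p) ^ k" for k
      using padic_integer_approx[OF p N0[OF N(1)], of k] by metis
    then obtain a where a: "\<And>k. 0 \<le> a k" "\<And>k. a k < int p ^ k"
      "\<And>k. padic_norm p (X (N k) - of_int (a k)) \<le> (1 / real p) ^ k" by metis
    have near: "padic_norm p (X n - of_int (a k)) \<le> (1 / real p) ^ k" if "n \<ge> N k" for n k
      using padic_norm_diff_le[OF p N(2)[OF that, of "N k"], of "of_int (a k) - X (N k)"] a(3)[of k]
      by (simp add: padic_norm_minus_commute[OF p, of "of_int (a k)"])
    have mem: "a \<in> residue_roots p f"
      unfolding residue_roots_def
    proof (intro CollectI allI conjI)
      fix k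
      show "0 \<le> a k" "a k < int p ^ k" by (rule a)+
      define n where "n = max (N k) (N (Suc k))"
      have "padic_norm p (X n - of_int (a (Suc k))) \<le> (1 / real p) ^ Suc k"
        by (rule near) (simp add: n_def)
      also have "\<dots> \<le> (1 / real p) ^ k" using p1 by (intro power_decreasing) auto
      finally have "padic_norm p ((X n - of_int (a k)) - (X n - of_int (a (Suc k)))) \<le> (1 / real p) ^ k"
        by (intro padic_norm_diff_le[OF p near]) (simp_all add: n_def)
      then have "padic_norm p (of_int (a (Suc k) - a k)) \<le> (1 / real p) ^ k" by simp
      then show "int p ^ k dvd a (Suc k) - a k" by (simp only: padic_norm_le_iff_int[OF p])
      have n: "n \<ge> N k" by (simp add: n_def)
      have "padic_norm p (rat_eval f (X n) - rat_eval f (of_int (a k))) \<le> (1 / real p) ^ k"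
        using rat_eval_diff_le[OF p N0 padic_norm_of_int_le_1[OF p], of n f "a k"] near[OF n] n N(1)[of k]
        by simp
      from padic_norm_diff_le[OF p N(3)[OF n] this]
      have "padic_norm p (of_int (poly f (a k))) \<le> (1 / real p) ^ k" by (simp add: rat_eval_of_int)
      then show "int p ^ k dvd poly f (a k)" by (simp only: padic_norm_le_iff_int[OF p])
    qed
    have "(\<lambda>k. X k - of_int (a k)) \<in> padic_null p"
      unfolding padic_null_iff
    proof (intro allI impI)
      fix e :: real assume "e > 0"
      then obtain K where K: "(1 / real p) ^ K < e" using p_power_small[OF p] by blast
      have "padic_norm p (X n - of_int (a n)) < e" if "n \<ge> max K (N K)" for n
      proof -
        have "int p ^ K dvd a n - a K" using residue_roots_mono[OF mem] that by simp
        then have "padic_norm p (of_int (a n) - of_int (a K)) \<le> (1 / real p) ^ K"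
          by (simp only: padic_norm_le_iff_int[OF p, symmetric] of_int_diff)
        from padic_norm_diff_le[OF p near this] that
        have "padic_norm p (X n - of_int (a n)) \<le> (1 / real p) ^ K" by simp
        then show ?thesis using K by simp
      qed
      then show "\<exists>N. \<forall>n\<ge>N. padic_norm p (X n - of_int (a n)) < e" by blast
    qed
    then have "x = \<Phi> a" unfolding x \<Phi>_def using padic_coset_eq_iff[OF p X C[OF mem]] by simp
    then show "x \<in> \<Phi> ` residue_roots p f" using mem by blast
  qed
  show ?thesis
    unfolding num_roots_def img[symmetric] by (rule card_image[OF inj])
qed

section \<open>Simple unit roots by Hensel lifting\<close>

lemma poly_taylor2:
  fixes f :: "int poly"
  obtains g where "poly f (x + h) = poly f x + h * poly (pderiv f) x + h\<^sup>2 * g"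
proof -
  have "\<exists>g. poly f (x + h) = poly f x + h * poly (pderiv f) x + h\<^sup>2 * g"
  proof (induction f)
    case (pCons a q)
    then obtain g where g: "poly q (x + h) = poly q x + h * poly (pderiv q) x + h\<^sup>2 * g" by blast
    show ?case
      unfolding poly_pCons g pderiv_pCons poly_add
      by (rule exI[of _ "poly (pderiv q) x + x * g + h * g"])
        (simp add: algebra_simps power2_eq_square)
  qed simp
  then show ?thesis using that by blast
qed

lemma poly_diff_dvd:
  fixes f :: "int poly"
  shows "y - x dvd poly f y - poly f x"
proof -
  obtain g where "poly f (x + (y - x)) = poly f x + (y - x) * poly (pderiv f) x + (y - x)\<^sup>2 * g"
    by (rule poly_taylor2)
  then show ?thesis by (simp add: power2_eq_square)
qed

lemma poly_dvd_cong:
  fixes f :: "int poly"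
  assumes "d dvd y - x"
  shows "d dvd poly f y \<longleftrightarrow> d dvd poly f x"
  using dvd_trans[OF assms poly_diff_dvd[of y x f]] by (metis dvd_diff_commute dvd_diff_right_iff dvd_diff_left_iff)

lemma prime_power_dvd_multD:
  fixes y D :: int
  assumes p: "prime p" and dvd: "int p ^ K dvd y * D" and nd: "\<not> int p ^ k dvd D"
  shows "int p ^ (K - k) dvd y"
proof (cases "y = 0")
  case False
  have D: "D \<noteq> 0" using nd by auto
  have pp: "prime_elem (int p)" using p by simp
  have nu: "\<not> is_unit (int p)" using prime_gt_1_nat[OF p] by simp
  have "K \<le> multiplicity (int p) (y * D)"
    using dvd False D nu by (simp add: power_dvd_iff_le_multiplicity)
  also have "\<dots> = multiplicity (int p) y + multiplicity (int p) D"
    using False D by (simp add: prime_elem_multiplicity_mult_distrib[OF pp])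
  finally have "K - k \<le> multiplicity (int p) y"
    using nd D nu by (simp add: power_dvd_iff_le_multiplicity)
  then show ?thesis using False nu by (simp add: power_dvd_iff_le_multiplicity)
qed simp

text \<open>The difference of the values at two points \<open>x\<close> and \<open>y\<close> is \<open>y - x\<close> times a factor congruent to \<open>f'(x)\<close> modulo
  \<open>p\<^sup>k\<close>. That factor is not divisible by \<open>p\<^sup>k\<close>, so fewer than \<open>k\<close> of the factors \<open>p\<close> of the difference of the
  values are lost on passing to \<open>y - x\<close>.\<close>

lemma hensel_unique:
  assumes p: "prime p" and a: "a \<in> residue_roots p f" and b: "b \<in> residue_roots p f"
    and eq: "a k = b k" and simple: "\<not> int p ^ k dvd poly (pderiv f) (a k)"
  shows "a = b"
proof
  fix j
  \<comment> \<open>precision \<open>k\<close> is lost in dividing by the derivative\<close>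
  define K where "K = j + k"
  define h where "h = b K - a K"
  obtain g where g: "poly f (a K + h) = poly f (a K) + h * poly (pderiv f) (a K) + h\<^sup>2 * g"
    by (rule poly_taylor2)
  have a': "int p ^ k dvd a K - a k" and b': "int p ^ k dvd b K - b k"
    using residue_roots_mono[OF a, of k K] residue_roots_mono[OF b, of k K] by (auto simp: K_def)
  have h: "int p ^ k dvd h"
    using dvd_diff[OF b' a'] eq by (simp add: h_def)
  have "\<not> int p ^ k dvd poly (pderiv f) (a K)"
    using simple poly_dvd_cong[OF a'] by blast
  then have nd: "\<not> int p ^ k dvd poly (pderiv f) (a K) + h * g"
    using h by (simp add: dvd_add_left_iff)
  have "int p ^ K dvd poly f (a K + h) - poly f (a K)"
    using residue_roots_D(3)[OF a, of K] residue_roots_D(3)[OF b, of K] by (simp add: h_def)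
  also have "poly f (a K + h) - poly f (a K) = h * (poly (pderiv f) (a K) + h * g)"
    unfolding g by (simp add: power2_eq_square algebra_simps)
  finally have "int p ^ (K - k) dvd h" using prime_power_dvd_multD[OF p _ nd] by blast
  then have "int p ^ j dvd b K - a K" by (simp add: K_def h_def)
  moreover have "int p ^ j dvd b K - b j" "int p ^ j dvd a K - a j"
    using residue_roots_mono[OF b, of j K] residue_roots_mono[OF a, of j K] by (auto simp: K_def)
  ultimately have "int p ^ j dvd (b K - a K) - (b K - b j) + (a K - a j)"
    by (intro dvd_add[of _ "(b K - a K) - (b K - b j)"] dvd_diff[of _ "b K - a K"])
  then have "int p ^ j dvd b j - a j" by simp
  then show "a j = b j" using residue_roots_eqI[OF b a] by metis
qed

text \<open>Newton's method one digit at a time: changing \<open>x\<close> by \<open>p\<close> to the power \<open>k + i\<close> times \<open>t\<close> changes \<open>f(x)\<close> linearly in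
  \<open>t\<close> modulo the square of that power, and the slope \<open>f'(x)\<close> is a unit times \<open>p\<^sup>v\<close>. As \<open>v < k\<close>, the square
  does not disturb the next digit, which a suitable \<open>t\<close> makes vanish.\<close>

lemma hensel_exists:
  assumes p: "prime p" and v: "v < k" and der: "int p ^ v dvd poly (pderiv f) r"
    and nder: "\<not> int p ^ Suc v dvd poly (pderiv f) r"
    and val: "int p ^ (k + v) dvd poly f r" and r: "0 \<le> r" "r < int p ^ k"
  obtains a where "a \<in> residue_roots p f" "a k = r"
proof -
  define P where "P i x \<longleftrightarrow> int p ^ (k + v + i) dvd poly f x \<and> int p ^ v dvd poly (pderiv f) x \<and>
     \<not> int p ^ Suc v dvd poly (pderiv f) x" for i x
  have pk: "int p ^ j > 0" for j using prime_gt_0_nat[OF p] by simp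
  have "\<exists>x. (\<forall>i. P i (x i) \<and> int p ^ (k + i) dvd x (Suc i) - x i) \<and> x 0 = r"
  proof -
    have step: "\<exists>y. P (Suc i) y \<and> int p ^ (k + i) dvd y - x" if Px: "P i x" for i x
    proof -
      obtain s u where s: "poly f x = int p ^ (k + v + i) * s" and u: "poly (pderiv f) x = int p ^ v * u"
        using Px unfolding P_def by (auto elim!: dvdE)
      have "\<not> int p dvd u" using Px u pk[of v] by (auto simp: P_def)
      then have "coprime (int p) u" using p by (simp add: prime_imp_coprime)
      then have "coprime u (int p)" by (simp add: coprime_commute)
      then obtain e where e: "[u * e = 1] (mod int p)"
        using coprime_iff_invertible_int by blast
      define t where "t = - s * e"
      define y where "y = x + int p ^ (k + i) * t"
      have "int p dvd (u * e - 1) * (- s)" using e by (simp add: cong_iff_dvd_diff)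
      then have dvd: "int p dvd s + t * u" by (simp add: t_def algebra_simps)
      have yx: "int p ^ (k + i) dvd y - x" by (simp add: y_def)
      have yx': "int p ^ v dvd y - x" "int p ^ Suc v dvd y - x"
        using v by (auto intro!: dvd_trans[OF le_imp_power_dvd yx] simp del: power_Suc)
      obtain g where g: "poly f (x + int p ^ (k + i) * t) = poly f x
          + int p ^ (k + i) * t * poly (pderiv f) x + (int p ^ (k + i) * t)\<^sup>2 * g"
        by (rule poly_taylor2)
      have "poly f y = int p ^ (k + v + i) * (s + t * u) + int p ^ ((k + i) + (k + i)) * (t\<^sup>2 * g)"
        unfolding y_def g s u by (simp add: algebra_simps power_add power2_eq_square)
      moreover have "int p ^ (k + v + Suc i) dvd int p ^ (k + v + i) * (s + t * u)"
        using dvd by (simp add: power_add mult_ac mult_dvd_mono)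
      moreover have "int p ^ (k + v + Suc i) dvd int p ^ ((k + i) + (k + i)) * (t\<^sup>2 * g)"
        using v by (intro dvd_mult2 le_imp_power_dvd) simp
      ultimately have "int p ^ (k + v + Suc i) dvd poly f y" by (simp only: dvd_add)
      then have "P (Suc i) y"
        using Px poly_dvd_cong[OF yx'(1)] poly_dvd_cong[OF yx'(2)] unfolding P_def by blast
      then show ?thesis using yx by blast
    qed
    have P0: "P 0 r" using assms by (simp add: P_def)
    define x where "x = rec_nat r (\<lambda>i z. SOME y. P (Suc i) y \<and> int p ^ (k + i) dvd y - z)"
    have x0: "x 0 = r" by (simp add: x_def)
    have xS: "x (Suc i) = (SOME y. P (Suc i) y \<and> int p ^ (k + i) dvd y - x i)" for i
      by (simp add: x_def)
    have ind: "P i (x i)" for i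
    proof (induction i)
      case (Suc i)
      show ?case using someI_ex[OF step[OF Suc]] xS by simp
    qed (simp add: x0 P0)
    then show ?thesis using someI_ex[OF step] x0 xS by metis
  qed
  then obtain x where x: "\<And>i. P i (x i)" "\<And>i. int p ^ (k + i) dvd x (Suc i) - x i" "x 0 = r" by blast
  define a where "a j = x j mod int p ^ j" for j
  have ax: "int p ^ j dvd a j - x j" for j by (simp add: a_def mod_eq_dvd_iff[symmetric])
  have "a \<in> residue_roots p f"
    unfolding residue_roots_def
  proof (intro CollectI allI conjI)
    fix j
    show "0 \<le> a j" "a j < int p ^ j" using pk[of j] by (auto simp: a_def)
    have "int p ^ j dvd a (Suc j) - x (Suc j)"
      using ax[of "Suc j"] by (meson dvd_trans le_imp_power_dvd le_SucI order_refl)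
    moreover have "int p ^ j dvd x (Suc j) - x j"
      using x(2)[of j] by (meson dvd_trans le_imp_power_dvd le_add2)
    ultimately have "int p ^ j dvd (a (Suc j) - x (Suc j)) + (x (Suc j) - x j) - (a j - x j)"
      using ax[of j]
      by (intro dvd_diff[of _ "(a (Suc j) - x (Suc j)) + (x (Suc j) - x j)"] dvd_add[of _ "a (Suc j) - x (Suc j)"])
    then show "int p ^ j dvd a (Suc j) - a j" by simp
    have "int p ^ j dvd poly f (x j)"
      using x(1)[of j] unfolding P_def by (meson dvd_trans le_imp_power_dvd le_add2)
    then show "int p ^ j dvd poly f (a j)" using poly_dvd_cong[OF ax] by blast
  qed
  moreover have "a k = r"
  proof -
    have "int p ^ k dvd x i - r" for i
    proof (induction i)
      case (Suc i)
      have "int p ^ k dvd x (Suc i) - x i"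
        using x(2)[of i] by (meson dvd_trans le_imp_power_dvd le_add1)
      from dvd_add[OF this Suc] show ?case by simp
    qed (simp add: x)
    then have "x k mod int p ^ k = r mod int p ^ k" by (simp add: mod_eq_dvd_iff)
    then show ?thesis using r by (simp add: a_def)
  qed
  ultimately show ?thesis using that by blast
qed

text \<open>The converse condition for lifting, read off from the Taylor expansion of \<open>f\<close> at the root: both the linear and
  the quadratic term are divisible by \<open>p\<^sup>k p\<^sup>v\<close>.\<close>

lemma root_valuation:
  assumes a: "a \<in> residue_roots p f" and v: "v < k" and der: "int p ^ v dvd poly (pderiv f) (a k)"
  shows "int p ^ (k + v) dvd poly f (a k)"
proof -
  \<comment> \<open>precision \<open>2k\<close> exceeds \<open>k + v\<close>, so \<open>f(x)\<close> does not contribute\<close>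
  define x where "x = a (2 * k)"
  have xk: "int p ^ k dvd a k - x"
    using residue_roots_mono[OF a, of k "2 * k"] by (simp add: x_def dvd_diff_commute)
  obtain g where g: "poly f (x + (a k - x)) = poly f x + (a k - x) * poly (pderiv f) x + (a k - x)\<^sup>2 * g"
    by (rule poly_taylor2)
  have xv: "int p ^ v dvd a k - x" using xk v by (meson dvd_trans le_imp_power_dvd less_imp_le)
  have dx: "int p ^ v dvd poly (pderiv f) x" using der poly_dvd_cong[OF xv] by blast
  have "int p ^ (2 * k) dvd poly f x" using residue_roots_D(3)[OF a] by (simp add: x_def)
  then have "int p ^ (k + v) dvd poly f x"
    using v by (elim dvd_trans[rotated]) (simp add: le_imp_power_dvd)
  moreover have "int p ^ (k + v) dvd (a k - x) * poly (pderiv f) x"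
    unfolding power_add by (rule mult_dvd_mono[OF xk dx])
  moreover have "int p ^ (k + v) dvd (a k - x)\<^sup>2 * g"
    unfolding power_add power2_eq_square by (intro dvd_mult2 mult_dvd_mono xk xv)
  ultimately show ?thesis using g by simp
qed

definition unit_residues :: "nat \<Rightarrow> nat \<Rightarrow> int set" where
  "unit_residues p k = {r \<in> {0..<int p ^ k}. \<not> int p dvd r}"

definition unit_roots :: "nat \<Rightarrow> int poly \<Rightarrow> (nat \<Rightarrow> int) set" where
  "unit_roots p f = {a \<in> residue_roots p f. a 1 \<noteq> 0}"

lemma finite_unit_residues: "finite (unit_residues p k)"
  unfolding unit_residues_def by (rule finite_subset[of _ "{0..<int p ^ k}"]) auto

lemma unit_root_iff:
  assumes "a \<in> residue_roots p f" "k > 0"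
  shows "a 1 \<noteq> 0 \<longleftrightarrow> \<not> int p dvd a k"
proof -
  have "int p dvd a k - a 1" using residue_roots_mono[OF assms(1), of 1 k] assms(2) by simp
  then have "int p dvd a k \<longleftrightarrow> int p dvd a 1" by (metis dvd_diff_left_iff dvd_diff_right_iff)
  also have "\<dots> \<longleftrightarrow> a 1 = 0"
    using residue_roots_D[OF assms(1), of 1] by (auto dest: zdvd_imp_le)
  finally show ?thesis by blast
qed

lemma simple_unit_roots_bij:
  assumes p: "prime p" and k: "k > 0"
  shows "bij_betw (\<lambda>a. a k) {a \<in> unit_roots p f. \<not> int p ^ k dvd poly (pderiv f) (a k)}
    {r \<in> unit_residues p k. \<exists>v<k. int p ^ (k + v) dvd poly f r \<and>
        int p ^ v dvd poly (pderiv f) r \<and> \<not> int p ^ Suc v dvd poly (pderiv f) r}"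
    (is "bij_betw _ ?A ?B")
proof (rule bij_betwI')
  fix a b assume "a \<in> ?A" "b \<in> ?A"
  then show "a k = b k \<longleftrightarrow> a = b" using hensel_unique[OF p] by (auto simp: unit_roots_def)
next
  fix a assume a: "a \<in> ?A"
  then have R: "a \<in> residue_roots p f" by (simp add: unit_roots_def)
  have "\<exists>v\<le>k. int p ^ v dvd poly (pderiv f) (a k) \<and> v < k \<and> \<not> int p ^ Suc v dvd poly (pderiv f) (a k)"
  proof -
    let ?Q = "\<lambda>v. \<not> int p ^ v dvd poly (pderiv f) (a k)"
    have Qk: "?Q k" using a by simp
    define v where "v = (LEAST v. ?Q v)"
    have "?Q v" "v \<le> k" unfolding v_def using LeastI[of ?Q, OF Qk] Least_le[of ?Q, OF Qk] by auto
    moreover have "v \<noteq> 0"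
    proof
      assume "v = 0" then show False using \<open>?Q v\<close> by simp
    qed
    then obtain w where w: "v = Suc w" by (cases v) auto
    moreover have "\<not> ?Q w" using not_less_Least[of w ?Q] w by (simp add: v_def)
    ultimately show ?thesis by (intro exI[of _ w]) auto
  qed
  then obtain v where v: "v < k" "int p ^ v dvd poly (pderiv f) (a k)"
    "\<not> int p ^ Suc v dvd poly (pderiv f) (a k)" by blast
  then show "a k \<in> ?B"
    using root_valuation[OF R v(1,2)] residue_roots_D[OF R, of k] a unit_root_iff[OF R k]
    by (auto simp: unit_residues_def unit_roots_def)
next
  fix r assume r: "r \<in> ?B"
  then obtain v where v: "v < k" "int p ^ (k + v) dvd poly f r"
    "int p ^ v dvd poly (pderiv f) r" "\<not> int p ^ Suc v dvd poly (pderiv f) r" by blast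
  from r have r': "0 \<le> r" "r < int p ^ k" "\<not> int p dvd r" by (auto simp: unit_residues_def)
  obtain a where a: "a \<in> residue_roots p f" "a k = r"
    using hensel_exists[OF p v(1,3,4,2) r'(1,2)] by blast
  have "\<not> int p ^ k dvd poly (pderiv f) r"
    using v(1,4) by (meson Suc_leI dvd_trans le_imp_power_dvd)
  then have "a \<in> ?A" using a r' unit_root_iff[OF a(1) k] by (simp add: unit_roots_def)
  then show "\<exists>a\<in>?A. r = a k" using a by auto
qed

lemma sum_of_bool_unique:
  assumes "finite A" "\<And>x y. x \<in> A \<Longrightarrow> y \<in> A \<Longrightarrow> Q x \<Longrightarrow> Q y \<Longrightarrow> x = y"
  shows "(\<Sum>x\<in>A. of_bool (Q x)) = (of_bool (\<exists>x\<in>A. Q x) :: real)"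
proof (cases "\<exists>x\<in>A. Q x")
  case True
  then obtain x where x: "x \<in> A" "Q x" by blast
  have "(\<Sum>y\<in>A. of_bool (Q y)) = (\<Sum>y\<in>A. if y = x then 1 else 0 :: real)"
    using assms(2) x by (intro sum.cong) auto
  then show ?thesis using True x assms(1) by simp
qed auto

text \<open>The event that \<open>p\<^sup>v\<close> exactly divides \<open>f'(r)\<close> is written as a difference of two divisibility events, because
  equidistribution will be available for pure divisibility conditions.\<close>

lemma card_simple_unit_roots:
  assumes p: "prime p" and k: "k > 0"
  shows "real (card {a \<in> unit_roots p f. \<not> int p ^ k dvd poly (pderiv f) (a k)}) =
    (\<Sum>r\<in>unit_residues p k. \<Sum>v<k.
        of_bool (int p ^ (k + v) dvd poly f r \<and> int p ^ v dvd poly (pderiv f) r)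
      - of_bool (int p ^ (k + v) dvd poly f r \<and> int p ^ Suc v dvd poly (pderiv f) r))"
proof -
  define Q where "Q r v \<longleftrightarrow> int p ^ (k + v) dvd poly f r \<and>
        int p ^ v dvd poly (pderiv f) r \<and> \<not> int p ^ Suc v dvd poly (pderiv f) r" for r v
  have "card {a \<in> unit_roots p f. \<not> int p ^ k dvd poly (pderiv f) (a k)} =
     card {r \<in> unit_residues p k. \<exists>v<k. Q r v}"
    unfolding Q_def by (rule bij_betw_same_card[OF simple_unit_roots_bij[OF p k]])
  also have "real \<dots> = (\<Sum>r\<in>unit_residues p k. of_bool (\<exists>v\<in>{..<k}. Q r v))"
    by (simp add: finite_unit_residues Int_def Bex_def)
  also have "\<dots> = (\<Sum>r\<in>unit_residues p k. \<Sum>v<k. of_bool (Q r v))"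
  proof (intro sum.cong refl sum_of_bool_unique[symmetric])
    fix r v w assume "Q r v" "Q r w"
    then have "\<not> Suc v \<le> w" "\<not> Suc w \<le> v"
      unfolding Q_def by (meson dvd_trans le_imp_power_dvd)+
    then show "v = w" by simp
  qed auto
  also have "\<dots> = (\<Sum>r\<in>unit_residues p k. \<Sum>v<k.
        of_bool (int p ^ (k + v) dvd poly f r \<and> int p ^ v dvd poly (pderiv f) r)
      - of_bool (int p ^ (k + v) dvd poly f r \<and> int p ^ Suc v dvd poly (pderiv f) r))"
  proof (intro sum.cong refl)
    fix r v
    have "int p ^ v dvd poly (pderiv f) r" if "int p ^ Suc v dvd poly (pderiv f) r"
      using that by (meson dvd_trans le_imp_power_dvd le_SucI order_refl)
    then show "of_bool (Q r v) = (of_bool (int p ^ (k + v) dvd poly f r \<and> int p ^ v dvd poly (pderiv f) r)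
      - of_bool (int p ^ (k + v) dvd poly f r \<and> int p ^ Suc v dvd poly (pderiv f) r) :: real)"
      unfolding Q_def by auto
  qed
  finally show ?thesis .
qed

section \<open>Bounding the number of roots by multiplicities modulo p\<close>

text \<open>If \<open>f\<close> has many approximate roots in the class of \<open>r\<close>, then \<open>r\<close> is a root of \<open>f\<close> modulo \<open>p\<close> of at least that
  multiplicity; multiplicity is expressed by the coefficients of \<open>f(X + r)\<close>. The roots are split off one by one.
  Dividing by \<open>X - x\<close> costs at most \<open>D\<close> powers of \<open>p\<close> in the values at the other roots, and the hypothesis on \<open>K\<close>
  ensures that the value at the last root is still divisible by \<open>p\<close>.\<close>

lemma taylor_coeffs_dvd_of_roots:
  fixes A :: "int set"
  assumes p: "prime p" and "finite A"
    and "\<And>x. x \<in> A \<Longrightarrow> int p dvd x - r"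
    and "\<And>x y. x \<in> A \<Longrightarrow> y \<in> A \<Longrightarrow> x \<noteq> y \<Longrightarrow> \<not> int p ^ D dvd y - x"
    and "\<And>x. x \<in> A \<Longrightarrow> int p ^ K dvd poly f x" and "K > D * card A"
    and "i < card A"
  shows "int p dvd coeff (pcompose f [:r, 1:]) i"
  using assms(2-)
proof (induction A arbitrary: f K i rule: finite_induct)
  case (insert x A)
  define g where "g = synthetic_div f x"
  have f: "f = [:- x, 1:] * g + [:poly f x:]" unfolding g_def by (rule synthetic_div_correct'[symmetric])
  have K: "K > D * card A + D" using insert.prems(4) insert.hyps by simp
  have gA: "int p ^ (K - D) dvd poly g y" if y: "y \<in> A" for y
  proof -
    have "poly f y - poly f x = poly g y * (y - x)"
      by (subst (1) f) (simp add: algebra_simps)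
    moreover have "int p ^ K dvd poly f y - poly f x" using insert.prems(3) y by auto
    moreover have "\<not> int p ^ D dvd y - x" using insert.prems(2)[of x y] insert.hyps y by auto
    ultimately show ?thesis using prime_power_dvd_multD[OF p] by metis
  qed
  have IH: "int p dvd coeff (pcompose g [:r, 1:]) j" if "j < card A" for j
    using insert.prems(1,2) gA K that by (intro insert.IH[of "K - D"]) auto
  have "pcompose [:- x, 1:] [:r, 1:] = [:r - x, 1:]" by (simp add: pcompose_pCons)
  then have "pcompose f [:r, 1:] = [:r - x, 1:] * pcompose g [:r, 1:] + [:poly f x:]"
    by (subst f) (simp only: pcompose_add pcompose_mult pcompose_const)
  then have c: "coeff (pcompose f [:r, 1:]) i = (r - x) * coeff (pcompose g [:r, 1:]) i
     + coeff (pCons 0 (pcompose g [:r, 1:])) i + coeff [:poly f x:] i"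
    by simp
  have "int p dvd r - x" using insert.prems(1)[of x] by (simp add: dvd_diff_commute)
  moreover have "int p dvd coeff (pCons 0 (pcompose g [:r, 1:])) i"
    using IH insert.prems(5) insert.hyps by (cases i) auto
  moreover have "int p dvd coeff [:poly f x:] i"
  proof (cases i)
    case 0
    have "int p dvd int p ^ K" using K by (intro dvd_power) simp
    then show ?thesis using 0 insert.prems(3)[of x] by (auto intro: dvd_trans)
  qed simp
  ultimately show ?case unfolding c by simp
qed simp

lemma card_roots_in_class:
  assumes p: "prime p" and i: "i < m" "\<not> int p dvd coeff (pcompose f [:r, 1:]) i"
  shows "finite {a \<in> residue_roots p f. a 1 = r}" and "card {a \<in> residue_roots p f. a 1 = r} < m"
proof -
  let ?R = "{a \<in> residue_roots p f. a 1 = r}"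
  have no: False if A: "A \<subseteq> ?R" "finite A" "card A = m" for A
  proof -
    have "\<exists>s. a \<noteq> b \<longrightarrow> a s \<noteq> b s" for a b :: "nat \<Rightarrow> int" by auto
    then obtain s where s: "\<And>a b :: nat \<Rightarrow> int. a \<noteq> b \<Longrightarrow> a (s a b) \<noteq> b (s a b)" by metis
    \<comment> \<open>any upper bound of the places at which two of the roots differ\<close>
    define D where "D = (\<Sum>a\<in>A. \<Sum>b\<in>A. s a b)"
    have sD: "s a b \<le> D" if "a \<in> A" "b \<in> A" for a b
    proof -
      have "s a b \<le> (\<Sum>b\<in>A. s a b)" using that A(2) by (intro member_le_sum) auto
      also have "\<dots> \<le> D" unfolding D_def
        using that A(2) by (intro member_le_sum[of _ _ "\<lambda>a. \<Sum>b\<in>A. s a b"]) auto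
      finally show ?thesis .
    qed
    \<comment> \<open>the separate summand \<open>D\<close> ensures \<open>D \<le> K\<close> also for \<open>m = 0\<close>\<close>
    define K where "K = D * m + D + 1"
    have KD: "D \<le> K" by (simp add: K_def)
    have sep: "\<not> int p ^ D dvd b K - a K" if ab: "a \<in> A" "b \<in> A" "a \<noteq> b" for a b
    proof
      assume "int p ^ D dvd b K - a K"
      define j where "j = s a b"
      have j: "j \<le> D" "j \<le> K" using sD ab KD by (auto simp: j_def intro: order_trans)
      have "int p ^ j dvd b K - a K"
        using \<open>int p ^ D dvd b K - a K\<close> j(1) by (meson dvd_trans le_imp_power_dvd)
      moreover have R: "a \<in> residue_roots p f" "b \<in> residue_roots p f" using ab A by auto
      moreover have "int p ^ j dvd b K - b j" "int p ^ j dvd a K - a j"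
        using residue_roots_mono[OF R(1) j(2)] residue_roots_mono[OF R(2) j(2)] by auto
      ultimately have "int p ^ j dvd (b K - a K) - (b K - b j) + (a K - a j)"
        by (intro dvd_add[of _ "(b K - a K) - (b K - b j)"] dvd_diff[of _ "b K - a K"])
      then have "int p ^ j dvd b j - a j" by simp
      then have "b j = a j" using residue_roots_eqI[OF R(2,1)] by blast
      then show False using s[OF ab(3)] by (simp add: j_def)
    qed
    have inj: "inj_on (\<lambda>a. a K) A" 
      using sep by (intro inj_onI) (metis diff_self dvd_0_right)
    then have card: "card ((\<lambda>a. a K) ` A) = m" using A by (simp add: card_image)
    have "int p dvd coeff (pcompose f [:r, 1:]) i"
    proof (rule taylor_coeffs_dvd_of_roots[OF p])
      show "finite ((\<lambda>a. a K) ` A)" using A by simp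
      show "int p dvd x - r" if "x \<in> (\<lambda>a. a K) ` A" for x
        using that A residue_roots_mono[of _ p f 1 K] by (auto simp: K_def)
      show "\<not> int p ^ D dvd y - x" if "x \<in> (\<lambda>a. a K) ` A" "y \<in> (\<lambda>a. a K) ` A" "x \<noteq> y" for x y
        using that sep by auto
      show "int p ^ K dvd poly f x" if "x \<in> (\<lambda>a. a K) ` A" for x
        using that A residue_roots_D(3) by auto
      show "K > D * card ((\<lambda>a. a K) ` A)" unfolding card by (simp add: K_def)
      show "i < card ((\<lambda>a. a K) ` A)" unfolding card by (rule i)
    qed
    then show False using i by simp
  qed
  show fin: "finite ?R"
  proof (rule ccontr)
    assume "infinite ?R"
    then obtain A where "A \<subseteq> ?R" "finite A" "card A = m" 
      using infinite_arbitrarily_large by blast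
    then show False by (rule no)
  qed
  show "card ?R < m"
  proof (rule ccontr)
    assume "\<not> card ?R < m"
    then have "m \<le> card ?R" by simp
    then obtain A where "A \<subseteq> ?R" "card A = m" "finite A"
      by (rule obtain_subset_with_card_n)
    then show False using no by blast
  qed
qed

lemma finite_card_roots_in_class:
  assumes p: "prime p" and monic: "lead_coeff f = 1"
  shows "finite {a \<in> residue_roots p f. a 1 = r}" and "card {a \<in> residue_roots p f. a 1 = r} \<le> degree f"
proof -
  have "coeff (pcompose f [:r, 1:]) (degree f) = 1"
    using monic lead_coeff_comp[of "[:r, 1:]" f] by (simp add: degree_pcompose)
  then have "\<not> int p dvd coeff (pcompose f [:r, 1:]) (degree f)"
    using prime_gt_1_nat[OF p] by simp
  from card_roots_in_class[OF p lessI this, of ]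
  show "finite {a \<in> residue_roots p f. a 1 = r}" "card {a \<in> residue_roots p f. a 1 = r} \<le> degree f"
    by auto
qed

lemma residue_roots_Union:
  "residue_roots p f = (\<Union>r\<in>{0..<int p}. {a \<in> residue_roots p f. a 1 = r})"
  using residue_roots_D[of _ p f 1] by auto

lemma finite_residue_roots:
  assumes p: "prime p" and monic: "lead_coeff f = 1"
  shows "finite (residue_roots p f)"
  by (subst residue_roots_Union) (intro finite_UN_I finite_card_roots_in_class[OF assms] finite_atLeastLessThan_int)

text \<open>Every class contributes at most \<open>m\<close> roots, except for the degenerate classes, where the degree is a bound.\<close>

lemma card_unit_roots_le:
  assumes p: "prime p" and monic: "lead_coeff f = 1"
  shows "real (card (unit_roots p f)) \<le> real p * real m + real (degree f) *
    (\<Sum>r\<in>unit_residues p 1. of_bool (\<forall>i<m. int p dvd coeff (pcompose f [:r, 1:]) i))"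
proof -
  have "unit_roots p f = (\<Union>r\<in>unit_residues p 1. {a \<in> residue_roots p f. a 1 = r})"
    using residue_roots_D[of _ p f 1] unit_root_iff[of _ p f 1]
    by (auto simp: unit_roots_def unit_residues_def)
  then have "card (unit_roots p f) \<le> (\<Sum>r\<in>unit_residues p 1. card {a \<in> residue_roots p f. a 1 = r})"
    by (simp add: card_UN_le finite_unit_residues)
  also have "real \<dots> \<le> (\<Sum>r\<in>unit_residues p 1. real m + real (degree f) *
      of_bool (\<forall>i<m. int p dvd coeff (pcompose f [:r, 1:]) i))"
    unfolding of_nat_sum
  proof (rule sum_mono)
    fix r
    show "real (card {a \<in> residue_roots p f. a 1 = r}) \<le> real m + real (degree f) *
      of_bool (\<forall>i<m. int p dvd coeff (pcompose f [:r, 1:]) i)"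
      using card_roots_in_class(2)[OF p, of _ m f r] finite_card_roots_in_class(2)[OF p monic, of r]
      by (cases "\<forall>i<m. int p dvd coeff (pcompose f [:r, 1:]) i") (auto intro: less_imp_le)
  qed
  also have "\<dots> = real (card (unit_residues p 1)) * real m + real (degree f) *
    (\<Sum>r\<in>unit_residues p 1. of_bool (\<forall>i<m. int p dvd coeff (pcompose f [:r, 1:]) i))"
    by (simp add: sum.distrib sum_distrib_left)
  also have "card (unit_residues p 1) \<le> p"
  proof -
    have "unit_residues p 1 \<subseteq> {0..<int p}" by (auto simp: unit_residues_def)
    then have "card (unit_residues p 1) \<le> card {0..<int p}" by (intro card_mono) auto
    then show ?thesis by simp
  qed
  finally show ?thesis by (simp add: mult_right_mono)
qed

text \<open>A product bound suffices: if there is a root at which \<open>f'\<close> vanishes modulo \<open>p\<^sup>k\<close> at all, then the second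
  factor is at least 1.\<close>

lemma card_multiple_unit_roots:
  assumes p: "prime p" and k: "k > 0" and monic: "lead_coeff f = 1"
  shows "real (card {a \<in> unit_roots p f. int p ^ k dvd poly (pderiv f) (a k)}) \<le>
     real (card (unit_roots p f)) *
     (\<Sum>r\<in>unit_residues p k. of_bool (int p ^ k dvd poly f r \<and> int p ^ k dvd poly (pderiv f) r))"
    (is "real (card ?B) \<le> _ * ?S")
proof (cases "?B = {}")
  case True
  show ?thesis unfolding True by (simp add: sum_nonneg)
next
  case False
  then obtain a where a: "a \<in> ?B" by blast
  then have R: "a \<in> residue_roots p f" by (simp add: unit_roots_def)
  have r: "a k \<in> unit_residues p k"
    using residue_roots_D[OF R, of k] a unit_root_iff[OF R k] by (auto simp: unit_residues_def unit_roots_def)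
  have "1 \<le> ?S"
    using member_le_sum[OF r, of "\<lambda>r. of_bool (int p ^ k dvd poly f r \<and> int p ^ k dvd poly (pderiv f) r) :: real"]
      a residue_roots_D(3)[OF R, of k] by (simp add: finite_unit_residues)
  moreover have "card ?B \<le> card (unit_roots p f)"
    using finite_subset[OF _ finite_residue_roots[OF p monic], of "unit_roots p f"]
    by (intro card_mono) (auto simp: unit_roots_def)
  ultimately show ?thesis
    using mult_mono[of "real (card ?B)" "real (card (unit_roots p f))" 1 ?S] by simp
qed

section \<open>Roots divisible by p\<close>

text \<open>Write \<open>f = X\<^sup>j g\<close> with \<open>g(0)\<close> nonzero, hence a unit by hypothesis. At a root in \<open>p\<int>\<^sub>p\<close> the value of \<open>g\<close> is a
  unit, so the power \<open>X\<^sup>j\<close> has to vanish there.\<close>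

lemma nonunit_roots:
  assumes p: "prime p" and f0: "f \<noteq> 0" and unit: "\<And>i. int p dvd coeff f i \<Longrightarrow> coeff f i = 0"
  shows "card {a \<in> residue_roots p f. a 1 = 0} = of_bool (coeff f 0 = 0)"
proof -
  obtain j g where g: "f = [:- 0, 1:] ^ j * g" "\<not> [:- 0, 1:] dvd g"
    by (rule exE[OF order_decomp[OF f0, of 0]]) (erule conjE, rule that)
  have fg: "f = monom 1 j * g" using g(1) by (simp add: monom_altdef)
  have g0: "\<not> int p dvd poly g 0"
  proof
    assume "int p dvd poly g 0"
    then have "int p dvd coeff f j" by (simp add: fg coeff_monom_mult poly_0_coeff_0)
    then have "coeff f j = 0" by (rule unit)
    then have "poly g 0 = 0" by (simp add: fg coeff_monom_mult poly_0_coeff_0)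
    then show False using g(2) by (simp add: poly_eq_0_iff_dvd)
  qed
  have zero: "a = (\<lambda>_. 0)" if a: "a \<in> residue_roots p f" "a 1 = 0" for a
  proof (rule ccontr)
    assume "a \<noteq> (\<lambda>_. 0)"
    then obtain k where k: "a k \<noteq> 0" by auto
    \<comment> \<open>more than the valuation of \<open>x\<^sup>j\<close> for an \<open>x\<close> not divisible by \<open>p\<^sup>k\<close>\<close>
    define K where "K = k * j + k + 1"
    have "int p dvd a K - a 1" using residue_roots_mono[OF a(1), of 1 K] by (simp add: K_def)
    then have "int p dvd a K - 0" using a(2) by simp
    then have "\<not> int p dvd poly g (a K)" using poly_dvd_cong g0 by blast
    then have ng: "\<not> int p ^ 1 dvd poly g (a K)" by simp
    have "int p ^ K dvd a K ^ j * poly g (a K)"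
      using residue_roots_D(3)[OF a(1), of K] by (simp add: fg poly_monom)
    from prime_power_dvd_multD[OF p this ng]
    have dvd: "int p ^ (k * j + k) dvd a K ^ j" by (simp add: K_def)
    have nk: "\<not> int p ^ k dvd a K"
    proof
      assume "int p ^ k dvd a K"
      moreover have "int p ^ k dvd a K - a k"
        using residue_roots_mono[OF a(1), of k K] by (simp add: K_def)
      ultimately have "int p ^ k dvd a k" by (metis dvd_diff_right_iff)
      then show False using k residue_roots_D[OF a(1), of k] zdvd_not_zless[of "a k" "int p ^ k"] by auto
    qed
    have "int p ^ ((k * i + k) - k * i) dvd 1" if "int p ^ (k * i + k) dvd a K ^ i" for i
      using that
    proof (induction i)
      case (Suc i)
      have "int p ^ (k * Suc i + k - k) dvd a K ^ i"
        using prime_power_dvd_multD[OF p _ nk, of "k * Suc i + k" "a K ^ i"] Suc.prems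
        by (simp add: mult.commute)
      then show ?case using Suc.IH by (simp add: add.commute)
    qed simp
    from this[OF dvd] have "int p ^ k dvd 1" by simp
    then have "int p ^ k dvd a K" by (meson dvd_trans one_dvd)
    then show False using nk by simp
  qed
  have mem: "(\<lambda>_. 0) \<in> residue_roots p f \<longleftrightarrow> coeff f 0 = 0"
  proof
    assume "(\<lambda>_. 0) \<in> residue_roots p f"
    then have "int p dvd poly f 0" using residue_roots_D(3)[of "\<lambda>_. 0" p f 1] by simp
    then show "coeff f 0 = 0" using unit by (simp add: poly_0_coeff_0)
  next
    assume "coeff f 0 = 0"
    then show "(\<lambda>_. 0) \<in> residue_roots p f"
      using prime_gt_0_nat[OF p] by (simp add: residue_roots_def poly_0_coeff_0)
  qed
  have "{a \<in> residue_roots p f. a 1 = 0} = (if coeff f 0 = 0 then {\<lambda>_. 0} else {})"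
    using zero mem by (auto split: if_splits)
  then show ?thesis by simp
qed

lemma residue_roots_split:
  assumes p: "prime p" and k: "k > 0" and monic: "lead_coeff f = 1"
    and unit: "\<And>i. int p dvd coeff f i \<Longrightarrow> coeff f i = 0"
  shows "real (card (residue_roots p f)) = of_bool (coeff f 0 = 0)
     + real (card {a \<in> unit_roots p f. \<not> int p ^ k dvd poly (pderiv f) (a k)})
     + real (card {a \<in> unit_roots p f. int p ^ k dvd poly (pderiv f) (a k)})"
proof -
  let ?A = "{a \<in> residue_roots p f. a 1 = 0}"
  let ?B = "{a \<in> unit_roots p f. \<not> int p ^ k dvd poly (pderiv f) (a k)}"
  let ?C = "{a \<in> unit_roots p f. int p ^ k dvd poly (pderiv f) (a k)}"
  have fin: "finite ?A" "finite ?B" "finite ?C"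
    using finite_residue_roots[OF p monic] by (auto simp: unit_roots_def)
  have "residue_roots p f = ?A \<union> (?B \<union> ?C)" by (auto simp: unit_roots_def)
  then have "card (residue_roots p f) = card ?A + card (?B \<union> ?C)"
    using fin by (subst card_Un_disjoint[symmetric]) (auto simp: unit_roots_def)
  also have "card (?B \<union> ?C) = card ?B + card ?C"
    using fin by (intro card_Un_disjoint) auto
  finally show ?thesis using nonunit_roots[OF p _ unit] monic by fastforce
qed

section \<open>Means over uniformly distributed coefficients\<close>

text \<open>Only the uniform distribution on a finite set of integers is considered, so expectations become finite averages over
  \<open>PiE\<close>, where independence is the interchange of product and sum.\<close>

definition mean_coeffs :: "nat \<Rightarrow> int set \<Rightarrow> ((nat \<Rightarrow> int) \<Rightarrow> real) \<Rightarrow> real" where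
  "mean_coeffs n S F = (\<Sum>c\<in>PiE {..<n} (\<lambda>_. S). F c) / real (card S) ^ n"

lemma mean_coeffs_mono:
  "(\<And>c. c \<in> PiE {..<n} (\<lambda>_. S) \<Longrightarrow> F c \<le> G c) \<Longrightarrow> mean_coeffs n S F \<le> mean_coeffs n S G"
  unfolding mean_coeffs_def by (intro divide_right_mono sum_mono) auto

lemma mean_coeffs_cong:
  "(\<And>c. c \<in> PiE {..<n} (\<lambda>_. S) \<Longrightarrow> F c = G c) \<Longrightarrow> mean_coeffs n S F = mean_coeffs n S G"
  unfolding mean_coeffs_def by simp

lemma mean_coeffs_add: "mean_coeffs n S (\<lambda>c. F c + G c) = mean_coeffs n S F + mean_coeffs n S G"
  by (simp add: mean_coeffs_def sum.distrib add_divide_distrib)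

lemma mean_coeffs_diff: "mean_coeffs n S (\<lambda>c. F c - G c) = mean_coeffs n S F - mean_coeffs n S G"
  by (simp add: mean_coeffs_def sum_subtractf diff_divide_distrib)

lemma mean_coeffs_cmult: "mean_coeffs n S (\<lambda>c. a * F c) = a * mean_coeffs n S F"
  by (simp add: mean_coeffs_def sum_distrib_left)

lemma mean_coeffs_sum: "mean_coeffs n S (\<lambda>c. \<Sum>r\<in>A. F r c) = (\<Sum>r\<in>A. mean_coeffs n S (F r))"
  unfolding mean_coeffs_def by (subst sum.swap) (simp add: sum_divide_distrib)

lemma mean_coeffs_prod:
  assumes "finite S" "S \<noteq> {}"
  shows "mean_coeffs n S (\<lambda>c. \<Prod>i<n. g i (c i)) = (\<Prod>i<n. (\<Sum>s\<in>S. g i s) / real (card S))"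
  using prod_sum_PiE[of "{..<n}" "\<lambda>_. S" g] assms by (simp add: mean_coeffs_def prod_dividef)

lemma mean_coeffs_first_zero:
  assumes S: "finite S" "S \<noteq> {}" and n: "n > 0"
  shows "mean_coeffs n S (\<lambda>c. of_bool (c 0 = 0)) = of_bool (0 \<in> S) / real (card S)"
proof -
  have "mean_coeffs n S (\<lambda>c. of_bool (c 0 = 0)) =
      mean_coeffs n S (\<lambda>c. \<Prod>i<n. if i = 0 then of_bool (c i = 0) else 1)"
    using n by (simp add: prod.delta)
  also have "\<dots> = (\<Prod>i<n. (\<Sum>s\<in>S. if i = 0 then of_bool (s = 0) else 1) / real (card S))"
    by (rule mean_coeffs_prod[OF S])
  also have "\<dots> = (\<Prod>i<n. if i = 0 then of_bool (0 \<in> S) / real (card S) else 1)"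
    using S by (intro prod.cong refl) (auto simp: of_bool_def sum.delta)
  finally show ?thesis using n by (simp add: prod.delta)
qed

lemma monic_poly_cong: "(\<And>i. i < n \<Longrightarrow> c i = d i) \<Longrightarrow> monic_poly n c = monic_poly n d"
  by (simp add: monic_poly_def)

lemma coeff_monic_poly: "coeff (monic_poly n c) i = (if i < n then c i else of_bool (i = n))"
  by (simp add: monic_poly_def coeff_sum)

lemma degree_monic_poly: "degree (monic_poly n c) = n"
proof (rule antisym)
  show "degree (monic_poly n c) \<le> n" by (rule degree_le) (simp add: coeff_monic_poly)
  show "n \<le> degree (monic_poly n c)" by (rule le_degree) (simp add: coeff_monic_poly)
qed

lemma lead_coeff_monic_poly: "lead_coeff (monic_poly n c) = 1"
  by (simp add: degree_monic_poly coeff_monic_poly)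

lemma expected_roots_eq_mean:
  assumes iid: "iid_uniform M n \<xi> S" and S: "finite S" "S \<noteq> {}" and n: "n > 0"
  shows "expected_roots p M n \<xi> = mean_coeffs n S (\<lambda>c. real (num_roots (padic_field p) (monic_poly n c)))"
proof -
  interpret prob_space M using iid by (simp add: iid_uniform_def)
  have ind: "indep_vars (\<lambda>_. count_space UNIV) \<xi> {..<n}"
    and dis: "\<And>i. i < n \<Longrightarrow> distr M (count_space UNIV) (\<xi> i) = measure_pmf (pmf_of_set S)"
    using iid by (auto simp: iid_uniform_def)
  have meas: "\<xi> i \<in> M \<rightarrow>\<^sub>M count_space UNIV" if "i < n" for i
    using ind that by (simp add: indep_vars_def)
  define F where "F c = real (num_roots (padic_field p) (monic_poly n c))" for c
  define A where "A c = (\<Inter>i\<in>{..<n}. \<xi> i -` {c i} \<inter> space M)" for c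
  have Asets: "A c \<in> sets M" for c
    unfolding A_def using n meas by (intro sets.finite_INT measurable_sets[OF meas]) auto
  have pA: "prob (A c) = 1 / real (card S) ^ n" if c: "c \<in> PiE {..<n} (\<lambda>_. S)" for c
  proof -
    have "prob (A c) = (\<Prod>i\<in>{..<n}. prob (\<xi> i -` {c i} \<inter> space M))"
      unfolding A_def using n by (intro indep_varsD_finite[OF ind]) auto
    also have "\<dots> = (\<Prod>i\<in>{..<n}. 1 / real (card S))"
    proof (intro prod.cong refl)
      fix i assume i: "i \<in> {..<n}"
      have "prob (\<xi> i -` {c i} \<inter> space M) = measure (distr M (count_space UNIV) (\<xi> i)) {c i}"
        using meas i by (simp add: measure_distr)
      also have "\<dots> = 1 / real (card S)"
        using dis i c S by (auto simp: measure_pmf_single indicator_def dest: PiE_mem)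
      finally show "prob (\<xi> i -` {c i} \<inter> space M) = 1 / real (card S)" .
    qed
    finally show ?thesis by (simp add: power_one_over)
  qed
  have AE: "AE \<omega> in M. \<forall>i\<in>{..<n}. \<xi> i \<omega> \<in> S"
  proof (subst AE_finite_all, simp, intro ballI)
    fix i assume i: "i \<in> {..<n}"
    have "AE x in measure_pmf (pmf_of_set S). x \<in> S"
      using S by (simp add: AE_measure_pmf_iff set_pmf_of_set)
    moreover have "distr M (count_space UNIV) (\<xi> i) = measure_pmf (pmf_of_set S)" using dis i by simp
    ultimately have "AE x in distr M (count_space UNIV) (\<xi> i). x \<in> S" by metis
    then show "AE \<omega> in M. \<xi> i \<omega> \<in> S" using meas i by (simp add: AE_distr_iff)
  qed
  have "expected_roots p M n \<xi> = (\<integral>\<omega>. (\<Sum>c\<in>PiE {..<n} (\<lambda>_. S). F c * indicator (A c) \<omega>) \<partial>M)"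
    unfolding expected_roots_def
  proof (rule integral_cong_AE)
    show "(\<lambda>\<omega>. \<Sum>c\<in>PiE {..<n} (\<lambda>_. S). F c * indicator (A c) \<omega>) \<in> borel_measurable M"
      using Asets by measurable
    \<comment> \<open>the integrand depends on finitely many integer variables, collected in a list, a countable type\<close>
    define X where "X \<omega> = map (\<lambda>i. \<xi> i \<omega>) [0..<n]" for \<omega>
    have "X -` {l} \<inter> space M \<in> sets M" for l
    proof (cases "length l = n")
      case True
      then have "X \<omega> = l \<longleftrightarrow> (\<forall>i<n. \<xi> i \<omega> = l ! i)" for \<omega>
        by (simp add: X_def list_eq_iff_nth_eq)
      then have "X -` {l} \<inter> space M = A (\<lambda>i. l ! i)"
        using n by (auto simp: A_def)
      then show ?thesis using Asets by simp
    next
      case False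
      then have "X -` {l} \<inter> space M = {}" by (auto simp: X_def)
      then show ?thesis by (metis sets.empty_sets)
    qed
    then have "X \<in> M \<rightarrow>\<^sub>M count_space UNIV"
      by (subst measurable_count_space_eq2_countable) auto
    then have "(\<lambda>\<omega>. F (\<lambda>i. X \<omega> ! i)) \<in> borel_measurable M"
      by (rule measurable_compose) simp
    also have "(\<lambda>\<omega>. F (\<lambda>i. X \<omega> ! i)) = (\<lambda>\<omega>. real (num_roots (padic_field p) (monic_poly n (\<lambda>i. \<xi> i \<omega>))))"
      unfolding F_def by (intro ext arg_cong[where f = "\<lambda>f. real (num_roots _ f)"] monic_poly_cong) (simp add: X_def)
    finally show "(\<lambda>\<omega>. real (num_roots (padic_field p) (monic_poly n (\<lambda>i. \<xi> i \<omega>)))) \<in> borel_measurable M" .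
    show "AE \<omega> in M. real (num_roots (padic_field p) (monic_poly n (\<lambda>i. \<xi> i \<omega>))) =
        (\<Sum>c\<in>PiE {..<n} (\<lambda>_. S). F c * indicator (A c) \<omega>)"
      using AE AE_space
    proof eventually_elim
      case (elim \<omega>)
      define d where "d = restrict (\<lambda>i. \<xi> i \<omega>) {..<n}"
      have d: "d \<in> PiE {..<n} (\<lambda>_. S)" using elim by (auto simp: d_def)
      have "indicator (A c) \<omega> = (if c = d then 1 else 0 :: real)" if "c \<in> PiE {..<n} (\<lambda>_. S)" for c
      proof -
        have "\<omega> \<in> A c \<longleftrightarrow> (\<forall>i<n. c i = d i)"
          using elim(2) n by (auto simp: A_def d_def)
        also have "\<dots> \<longleftrightarrow> c = d"
          using PiE_ext[OF that d] by auto
        finally have "\<omega> \<in> A c \<longleftrightarrow> c = d" .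
        then show ?thesis unfolding indicator_def by simp
      qed
      then have "(\<Sum>c\<in>PiE {..<n} (\<lambda>_. S). F c * indicator (A c) \<omega>) = (\<Sum>c\<in>PiE {..<n} (\<lambda>_. S). if c = d then F c else 0)"
        by (intro sum.cong) auto
      also have "\<dots> = F d" using d S by (simp add: finite_PiE)
      also have "F d = real (num_roots (padic_field p) (monic_poly n (\<lambda>i. \<xi> i \<omega>)))"
        unfolding F_def by (subst monic_poly_cong[of n d "\<lambda>i. \<xi> i \<omega>"]) (auto simp: d_def)
      finally show ?case by simp
    qed
  qed
  also have "\<dots> = (\<Sum>c\<in>PiE {..<n} (\<lambda>_. S). F c * prob (A c))"
    using Asets by (subst Bochner_Integration.integral_sum) (auto simp: less_top[symmetric] intro!: integrable_real_mult_indicator)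
  also have "\<dots> = mean_coeffs n S F"
    using pA by (simp add: mean_coeffs_def sum_divide_distrib)
  finally show ?thesis by (simp add: F_def[abs_def])
qed

section \<open>Equidistribution of the values of the polynomial and its derivative\<close>

text \<open>The additive character \<open>x \<mapsto> exp (2 \<pi> \<i> x / q)\<close> of the integers modulo \<open>q\<close>.\<close>

definition echar :: "nat \<Rightarrow> int \<Rightarrow> complex" where
  "echar q x = cis (2 * pi * (real_of_int x / real q))"

lemma echar_0 [simp]: "echar q 0 = 1"
  by (simp add: echar_def)

lemma echar_add: "echar q (x + y) = echar q x * echar q y"
  by (simp add: echar_def cis_mult add_divide_distrib distrib_left)

lemma echar_sum: "echar q (sum g A) = (\<Prod>i\<in>A. echar q (g i))"
  by (induction A rule: infinite_finite_induct) (simp_all add: echar_add)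

lemma norm_echar [simp]: "norm (echar q x) = 1"
  by (simp add: echar_def)

lemma echar_power: "echar q x ^ m = echar q (int m * x)"
  unfolding echar_def Complex.DeMoivre by (simp add: mult_ac)

lemma echar_scale: "m > 0 \<Longrightarrow> echar (m * q) (int m * x) = echar q x"
  by (simp add: echar_def)

lemma echar_eq_1_iff:
  assumes "q > 0"
  shows "echar q x = 1 \<longleftrightarrow> int q dvd x"
proof
  assume "int q dvd x"
  then obtain y where "x = int q * y" by blast
  then show "echar q x = 1" using assms by (simp add: echar_def)
next
  assume "echar q x = 1"
  then have "cos (2 * pi * (real_of_int x / real q)) = 1"
    by (simp add: echar_def complex_eq_iff)
  then obtain y where "2 * pi * (real_of_int x / real q) = real_of_int y * 2 * pi"
    unfolding cos_one_2pi_int by blast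
  then have "real_of_int x = real_of_int (y * int q)" using assms by (simp add: field_simps)
  then have "x = y * int q" by (simp only: of_int_eq_iff)
  then show "int q dvd x" by simp
qed

lemma echar_orthogonality:
  assumes "q > 0"
  shows "(\<Sum>a<q. echar q (int a * x)) = (if int q dvd x then of_nat q else 0)"
proof (cases "int q dvd x")
  case True
  then have "echar q (int a * x) = 1" for a using echar_eq_1_iff[OF assms] by simp
  then show ?thesis using True by simp
next
  case False
  then have ne: "echar q x \<noteq> 1" using echar_eq_1_iff[OF assms] by simp
  have "(\<Sum>a<q. echar q (int a * x)) = (echar q x ^ q - 1) / (echar q x - 1)"
    unfolding echar_power[symmetric] by (rule geometric_sum[OF ne])
  also have "echar q x ^ q = 1" by (simp add: echar_power echar_eq_1_iff[OF assms])
  finally show ?thesis using False by simp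
qed

text \<open>As the powers of \<open>z\<close> sum to 0, the numbers \<open>1 - z\<^sup>j\<close> for \<open>j < q\<close> sum to \<open>q\<close>. Each of them has modulus at most
  \<open>j \<bar>1 - z\<bar>\<close>, so \<open>\<bar>1 - z\<bar> \<ge> 1/q\<close>, and the parallelogram law turns this into a bound on \<open>1 + z\<close>.\<close>

lemma norm_one_plus_root_of_unity:
  fixes z :: complex
  assumes q: "q > 0" and zq: "z ^ q = 1" and z1: "z \<noteq> 1" and nz: "norm z = 1"
  shows "norm (1 + z) \<le> 2 - 1 / (4 * (real q)\<^sup>2)"
proof -
  have pw: "norm (1 - z ^ j) \<le> real j * norm (1 - z)" for j
  proof (induction j)
    case (Suc j)
    have "1 - z ^ Suc j = (1 - z) + z * (1 - z ^ j)" by (simp add: algebra_simps)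
    then have "norm (1 - z ^ Suc j) \<le> norm (1 - z) + norm (z * (1 - z ^ j))"
      by (metis norm_triangle_ineq)
    also have "norm (z * (1 - z ^ j)) = norm (1 - z ^ j)" by (simp add: norm_mult nz)
    finally show ?case using Suc by (simp add: algebra_simps)
  qed simp
  have "(\<Sum>j<q. z ^ j) = 0" using geometric_sum[OF z1, of q] zq by simp
  then have "of_nat q = (\<Sum>j<q. 1 - z ^ j)" by (simp add: sum_subtractf)
  then have "real q = norm (\<Sum>j<q. 1 - z ^ j)" by (metis norm_of_nat)
  also have "\<dots> \<le> (\<Sum>j<q. real q * norm (1 - z))"
    by (intro sum_norm_le order_trans[OF pw] mult_right_mono) auto
  finally have "1 \<le> real q * norm (1 - z)" using q by simp
  then have "1 \<le> (real q)\<^sup>2 * (norm (1 - z))\<^sup>2"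
    by (metis one_le_power power_mult_distrib)
  then have l: "1 / (real q)\<^sup>2 \<le> (norm (1 - z))\<^sup>2" using q by (simp add: field_simps)
  define d where "d = 1 / (real q)\<^sup>2"
  have d1: "d \<le> 1" "d \<ge> 0" using q by (auto simp: d_def)
  have "(norm (1 + z))\<^sup>2 + (norm (1 - z))\<^sup>2 = 2 + 2 * (norm z)\<^sup>2"
    unfolding cmod_power2 by (simp add: power2_eq_square algebra_simps)
  then have "(norm (1 + z))\<^sup>2 \<le> 4 - d" using l nz by (simp add: d_def)
  also have "\<dots> \<le> (2 - d / 4)\<^sup>2" by (simp add: power2_eq_square algebra_simps)
  finally have "norm (1 + z) \<le> 2 - d / 4"
    by (rule power2_le_imp_le) (use d1 in linarith)
  then show ?thesis by (simp add: d_def)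
qed

lemma norm_char_sum_le_card: "finite S \<Longrightarrow> norm (\<Sum>s\<in>S. echar q (s * t)) \<le> real (card S)"
  using sum_norm_le[of S "\<lambda>s. echar q (s * t)" "\<lambda>_. 1"] by simp

text \<open>The two terms of \<open>u\<close> and \<open>v\<close> cannot point in the same direction; the others are estimated trivially.\<close>

lemma norm_char_sum_le:
  assumes S: "finite S" "u \<in> S" "v \<in> S" and q: "q > 0" and nd: "\<not> int q dvd (v - u) * t"
  shows "norm (\<Sum>s\<in>S. echar q (s * t)) \<le> real (card S) - 1 / (4 * (real q)\<^sup>2)"
proof -
  have uv: "u \<noteq> v" using nd by auto
  define z where "z = echar q ((v - u) * t)"
  have "echar q (v * t) = echar q (u * t) * z"
    unfolding z_def echar_add[symmetric] by (simp add: algebra_simps)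
  then have "(\<Sum>s\<in>S. echar q (s * t)) = echar q (u * t) * (1 + z) + (\<Sum>s\<in>S-{u,v}. echar q (s * t))"
    using sum.remove[of S u "\<lambda>s. echar q (s * t)"] sum.remove[of "S - {u}" v "\<lambda>s. echar q (s * t)"] S uv
    by (simp add: distrib_left Diff_insert2[of S u "{v}"] insert_commute)
  then have "norm (\<Sum>s\<in>S. echar q (s * t)) \<le> norm (1 + z) + real (card (S - {u, v}))"
    using norm_triangle_ineq[of "echar q (u * t) * (1 + z)" "\<Sum>s\<in>S-{u,v}. echar q (s * t)"]
      norm_char_sum_le_card[of "S - {u,v}" q t] S
    by (simp add: norm_mult)
  moreover have "norm (1 + z) \<le> 2 - 1 / (4 * (real q)\<^sup>2)"
    using nd by (intro norm_one_plus_root_of_unity[OF q])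
      (auto simp: z_def echar_power echar_eq_1_iff[OF q])
  moreover have "real (card (S - {u, v})) = real (card S) - 2"
  proof -
    have "card {u, v} \<le> card S" using S by (intro card_mono) auto
    then show ?thesis using S uv by (simp add: card_Diff_subset of_nat_diff)
  qed
  ultimately show ?thesis by simp
qed

lemma prod_le_power_half:
  fixes g :: "nat \<Rightarrow> real"
  assumes "\<And>l. 0 \<le> g l" "\<And>l. g l \<le> 1" "0 \<le> \<rho>" "\<And>l. g l \<le> \<rho> \<or> g (Suc l) \<le> \<rho>"
  shows "(\<Prod>l<n. g l) \<le> \<rho> ^ (n div 2)"
proof (induction n rule: induct_nat_012)
  case (ge2 n)
  have "g n * g (Suc n) \<le> \<rho>"
    using assms(4)[of n] mult_mono[of "g n" \<rho> "g (Suc n)" 1] mult_mono[of "g n" 1 "g (Suc n)" \<rho>]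
      assms(1-3) by auto
  then have "(\<Prod>l<n. g l) * (g n * g (Suc n)) \<le> \<rho> ^ (n div 2) * \<rho>"
    using ge2 assms(1,3) by (intro mult_mono) (auto intro: prod_nonneg)
  then show ?case by (simp add: mult_ac)
qed (use assms in auto)

lemma poly_monic_poly: "poly (monic_poly n c) r = (\<Sum>l<n. c l * r ^ l) + r ^ n"
  by (simp add: monic_poly_def poly_sum poly_monom)

lemma poly_pderiv_monic_poly:
  "poly (pderiv (monic_poly n c)) r = (\<Sum>l<n. c l * (int l * r ^ (l - 1))) + int n * r ^ (n - 1)"
proof -
  have "pderiv (sum g A) = (\<Sum>i\<in>A. pderiv (g i))" for g :: "nat \<Rightarrow> int poly" and A
    by (induction A rule: infinite_finite_induct) (simp_all add: pderiv_add)
  then show ?thesis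
    by (simp add: monic_poly_def pderiv_add pderiv_monom poly_sum poly_monom mult_ac)
qed

text \<open>Here \<open>A r\<^sup>l + B l r\<^sup>l\<^sup>-\<^sup>1\<close> is the weight of the coefficient of \<open>X\<^sup>l\<close> in \<open>A f(r) + B f'(r)\<close>. A weight
  minus \<open>r\<close> times its predecessor is \<open>B\<close> times a power of the unit \<open>r\<close>, so two consecutive zeros modulo \<open>Q\<close> force
  \<open>B\<close> and then \<open>A\<close> to vanish.\<close>

lemma consecutive_weights_vanish:
  fixes A B r :: int
  assumes cop: "coprime r Q"
    and "Q dvd A * r ^ l + B * (int l * r ^ (l - 1))"
    and "Q dvd A * r ^ Suc l + B * (int (Suc l) * r ^ (Suc l - 1))"
  shows "Q dvd A \<and> Q dvd B"
proof -
  have cop': "coprime Q (r ^ l)" using cop by (simp add: coprime_commute)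
  have "B * r ^ l = (A * r ^ Suc l + B * (int (Suc l) * r ^ (Suc l - 1)))
     - r * (A * r ^ l + B * (int l * r ^ (l - 1)))"
    by (cases l) (simp_all add: algebra_simps)
  then have "Q dvd B * r ^ l" using assms(2,3) by (simp only: dvd_diff dvd_mult)
  then have B: "Q dvd B" using cop' by (simp add: coprime_dvd_mult_left_iff)
  then have "Q dvd A * r ^ l" using assms(2) by (simp add: dvd_add_left_iff)
  then have "Q dvd A" using cop' by (simp add: coprime_dvd_mult_left_iff)
  then show ?thesis using B by simp
qed

lemma contraction_factor_nonneg:
  fixes s q :: real
  assumes "1 \<le> s" "1 \<le> q"
  shows "0 \<le> 1 - 1 / (4 * s * q\<^sup>2)"
proof -
  have "1 \<le> s * q\<^sup>2" using mult_mono[OF assms(1), of 1 "q\<^sup>2"] assms by simp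
  then show ?thesis by (simp add: divide_le_eq_1)
qed

text \<open>By independence the sum factors into one character sum per coefficient, and at least every second factor
  is nontrivial.\<close>

lemma char_mean_bound:
  fixes p N :: nat and A B r :: int
  defines "q \<equiv> p ^ N"
  assumes p: "prime p" and S: "finite S" "u \<in> S" "v \<in> S" "\<not> int p dvd v - u"
    and r: "\<not> int p dvd r" and AB: "\<not> (int q dvd A \<and> int q dvd B)"
  shows "norm (\<Sum>c\<in>PiE {..<n} (\<lambda>_. S). 
      echar q (A * poly (monic_poly n c) r + B * poly (pderiv (monic_poly n c)) r))
    \<le> real (card S) ^ n * (1 - 1 / (4 * real (card S) * (real q)\<^sup>2)) ^ (n div 2)"
proof -
  define t where "t l = A * r ^ l + B * (int l * r ^ (l - 1))" for l
  define \<rho> where "\<rho> = 1 - 1 / (4 * real (card S) * (real q)\<^sup>2)"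
  have q: "q > 0" using prime_gt_0_nat[OF p] by (simp add: q_def)
  have cS: "real (card S) \<ge> 1" using S(1,2) by (auto simp: Suc_le_eq card_gt_0_iff)
  have \<rho>: "0 \<le> \<rho>" unfolding \<rho>_def using cS q by (intro contraction_factor_nonneg) auto
  have cop: "coprime x (int q)" if "\<not> int p dvd x" for x
  proof -
    have "coprime (int p) x" using that p by (simp add: prime_imp_coprime)
    then show ?thesis by (simp add: q_def coprime_commute)
  qed
  have "A * poly (monic_poly n c) r + B * poly (pderiv (monic_poly n c)) r =
     (\<Sum>l<n. c l * t l) + t n" for c
    unfolding poly_monic_poly poly_pderiv_monic_poly t_def
    by (simp add: algebra_simps sum.distrib sum_distrib_left)
  then have "(\<Sum>c\<in>PiE {..<n} (\<lambda>_. S). 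
      echar q (A * poly (monic_poly n c) r + B * poly (pderiv (monic_poly n c)) r)) =
     echar q (t n) * (\<Sum>c\<in>PiE {..<n} (\<lambda>_. S). \<Prod>l<n. echar q (c l * t l))"
    by (simp add: echar_add echar_sum sum_distrib_left mult_ac)
  also have "(\<Sum>c\<in>PiE {..<n} (\<lambda>_. S). \<Prod>l<n. echar q (c l * t l)) = (\<Prod>l<n. \<Sum>s\<in>S. echar q (s * t l))"
    by (rule prod_sum_PiE[symmetric]) (use S in auto)
  finally have "norm (\<Sum>c\<in>PiE {..<n} (\<lambda>_. S). 
      echar q (A * poly (monic_poly n c) r + B * poly (pderiv (monic_poly n c)) r)) =
      (\<Prod>l<n. norm (\<Sum>s\<in>S. echar q (s * t l)))"
    by (simp add: norm_mult prod_norm)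
  also have "\<dots> = real (card S) ^ n * (\<Prod>l<n. norm (\<Sum>s\<in>S. echar q (s * t l)) / real (card S))"
    using cS by (simp add: prod_dividef)
  also have "(\<Prod>l<n. norm (\<Sum>s\<in>S. echar q (s * t l)) / real (card S)) \<le> \<rho> ^ (n div 2)"
  proof (rule prod_le_power_half)
    show "norm (\<Sum>s\<in>S. echar q (s * t l)) / real (card S) \<le> 1" for l
      using norm_char_sum_le_card[OF S(1)] cS by (simp add: divide_le_eq_1)
    have small: "norm (\<Sum>s\<in>S. echar q (s * t l)) / real (card S) \<le> \<rho>" if "\<not> int q dvd t l" for l
    proof -
      have "\<not> int q dvd (v - u) * t l"
        using that cop[OF S(4)] by (simp add: coprime_commute coprime_dvd_mult_right_iff)
      from norm_char_sum_le[OF S(1-3) q this] show ?thesis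
        using cS by (simp add: \<rho>_def field_simps)
    qed
    show "norm (\<Sum>s\<in>S. echar q (s * t l)) / real (card S) \<le> \<rho> \<or>
       norm (\<Sum>s\<in>S. echar q (s * t (Suc l))) / real (card S) \<le> \<rho>" for l
      using small[of l] small[of "Suc l"] consecutive_weights_vanish[OF cop[OF r], of A l B] AB
      unfolding t_def by blast
  qed (use \<rho> in auto)
  finally show ?thesis using cS by (simp add: \<rho>_def mult_left_mono)
qed

lemma indicator_as_char_sum:
  assumes "q1 > 0" "q2 > 0"
  shows "complex_of_real (of_bool (int q1 dvd x \<and> int q2 dvd y)) =
    (\<Sum>(a, b)\<in>{..<q1} \<times> {..<q2}. echar q1 (int a * x) * echar q2 (int b * y)) / (of_nat q1 * of_nat q2)"
  unfolding sum.cartesian_product[symmetric] sum_product[symmetric]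
  using assms by (simp add: echar_orthogonality)

text \<open>Both divisibility conditions are expanded into characters. The trivial character gives the main term, and the
  others are bounded by \<open>char_mean_bound\<close> after rewriting them as characters of the common modulus \<open>p\<^sup>N\<close>.\<close>

lemma equidistribution:
  fixes p N i j :: nat and r :: int
  assumes p: "prime p" and S: "finite S" "u \<in> S" "v \<in> S" "\<not> int p dvd v - u"
    and r: "\<not> int p dvd r" and ij: "i \<le> N" "j \<le> N"
  shows "\<bar>mean_coeffs n S (\<lambda>c. of_bool (int p ^ i dvd poly (monic_poly n c) r \<and>
        int p ^ j dvd poly (pderiv (monic_poly n c)) r)) - 1 / real p ^ (i + j)\<bar>
    \<le> (1 - 1 / (4 * real (card S) * (real (p ^ N))\<^sup>2)) ^ (n div 2)"
proof -
  define E where "E = (1 - 1 / (4 * real (card S) * (real (p ^ N))\<^sup>2)) ^ (n div 2)"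
  define X Y where "X c = poly (monic_poly n c) r" and "Y c = poly (pderiv (monic_poly n c)) r" for c
  define C where "C = PiE {..<n} (\<lambda>_. S)"
  define I where "I = {..<p ^ i} \<times> {..<p ^ j}"
  define T where "T ab = (\<Sum>c\<in>C. echar (p ^ i) (int (fst ab) * X c) * echar (p ^ j) (int (snd ab) * Y c))
      / of_nat (card S) ^ n" for ab
  have p0: "p > 0" using prime_gt_0_nat[OF p] .
  have cS: "real (card S) \<ge> 1" using S(1,2) by (auto simp: Suc_le_eq card_gt_0_iff)
  have cC: "card C = card S ^ n" by (simp add: C_def card_PiE)
  have fI: "finite I" by (simp add: I_def)
  have "complex_of_real (mean_coeffs n S (\<lambda>c. of_bool (int p ^ i dvd X c \<and> int p ^ j dvd Y c)))
     = (\<Sum>c\<in>C. complex_of_real (of_bool (int (p ^ i) dvd X c \<and> int (p ^ j) dvd Y c))) / of_nat (card S) ^ n"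
    by (simp add: mean_coeffs_def C_def)
  also have "\<dots> = (\<Sum>ab\<in>I. T ab) / of_nat p ^ (i + j)"
    using p0 unfolding T_def I_def
    by (subst indicator_as_char_sum) (simp_all add: sum_divide_distrib sum.swap[of _ C] split_def power_add mult_ac)
  finally have mean: "complex_of_real (mean_coeffs n S (\<lambda>c. of_bool (int p ^ i dvd X c \<and> int p ^ j dvd Y c)))
     = (\<Sum>ab\<in>I. T ab) / of_nat p ^ (i + j)" .
  have z: "(0, 0) \<in> I" using p0 by (simp add: I_def)
  have "T (0, 0) = 1" using cS by (simp add: T_def cC)
  then have split: "(\<Sum>ab\<in>I. T ab) = 1 + (\<Sum>ab\<in>I-{(0,0)}. T ab)"
    using fI z by (simp add: sum.remove)
  have bound: "norm (T ab) \<le> E" if ab: "ab \<in> I - {(0,0)}" for ab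
  proof -
    obtain a b where [simp]: "ab = (a, b)" by force
    \<comment> \<open>numerators of the two frequencies over the common denominator \<open>p\<^sup>N\<close>\<close>
    define A B where "A = int (p ^ (N - i)) * int a" and "B = int (p ^ (N - j)) * int b"
    have scale: "echar (p ^ k) x = echar (p ^ N) (int (p ^ (N - k)) * x)" if "k \<le> N" for k x
    proof -
      have "p ^ N = p ^ (N - k) * p ^ k" using that by (simp flip: power_add)
      then show ?thesis using echar_scale[of "p ^ (N - k)" "p ^ k" x] p0 by simp
    qed
    have eq: "echar (p ^ i) (int a * X c) * echar (p ^ j) (int b * Y c) = echar (p ^ N) (A * X c + B * Y c)" for c
      unfolding scale[OF ij(1)] scale[OF ij(2)] echar_add by (simp add: A_def B_def mult_ac)
    have zero: "x = 0" if "x < p ^ k" "int (p ^ N) dvd int (p ^ (N - k)) * int x" "k \<le> N" for x k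
    proof -
      have "p ^ (N - k) * p ^ k dvd p ^ (N - k) * x"
        using that by (metis int_dvd_int_iff le_add_diff_inverse2 of_nat_mult power_add)
      then have "p ^ k dvd x" using p0 by simp
      then show ?thesis using that(1) by (auto dest: dvd_imp_le)
    qed
    have "\<not> (int (p ^ N) dvd A \<and> int (p ^ N) dvd B)"
      using ab zero[of a i] zero[of b j] ij by (auto simp: A_def B_def I_def)
    from char_mean_bound[OF p S r this, of n]
    have "norm (\<Sum>c\<in>C. echar (p ^ N) (A * X c + B * Y c)) \<le> real (card S) ^ n * E"
      by (simp add: C_def X_def Y_def E_def)
    then show ?thesis
      using cS by (simp add: T_def eq norm_divide norm_power divide_le_eq mult.commute)
  qed
  have E0: "E \<ge> 0"
    using contraction_factor_nonneg[OF cS, of "real (p ^ N)"] p0 by (simp add: E_def)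
  have pij: "real p ^ (i + j) > 0" using p0 by simp
  have "norm (\<Sum>ab\<in>I-{(0,0)}. T ab) \<le> (\<Sum>ab\<in>I-{(0,0)}. E)"
    by (intro sum_norm_le bound)
  also have "\<dots> \<le> (\<Sum>ab\<in>I. E)" using fI E0 by (intro sum_mono2) auto
  also have "\<dots> = real p ^ (i + j) * E" by (simp add: I_def power_add)
  finally have rest: "norm (\<Sum>ab\<in>I-{(0,0)}. T ab) \<le> real p ^ (i + j) * E" .
  define P where "P = mean_coeffs n S (\<lambda>c. of_bool (int p ^ i dvd X c \<and> int p ^ j dvd Y c))"
  have "complex_of_real (P - 1 / real p ^ (i + j)) = (\<Sum>ab\<in>I-{(0,0)}. T ab) / of_nat p ^ (i + j)"
    unfolding P_def of_real_diff mean split by (simp add: add_divide_distrib)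
  then have "norm (complex_of_real (P - 1 / real p ^ (i + j)))
     = norm ((\<Sum>ab\<in>I-{(0,0)}. T ab) / of_nat p ^ (i + j))" by (rule arg_cong)
  then have "\<bar>P - 1 / real p ^ (i + j)\<bar> = norm (\<Sum>ab\<in>I-{(0,0)}. T ab) / real p ^ (i + j)"
    by (simp only: norm_of_real norm_divide norm_power norm_of_nat)
  also have "\<dots> \<le> E" using rest pij by (simp add: divide_le_eq mult.commute)
  finally show ?thesis by (simp add: E_def P_def X_def Y_def)
qed

section \<open>Highly multiple roots modulo p are rare\<close>

text \<open>The difference of the two polynomials has degree less than \<open>m\<close>, so by hypothesis all coefficients of its shift by
  \<open>r\<close> are divisible by \<open>p\<close>; shifting back preserves this.\<close>

lemma taylor_coeffs_determine:
  assumes c: "\<And>i. i < m \<Longrightarrow> int p dvd coeff (pcompose (monic_poly n c) [:r, 1:]) i"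
    and d: "\<And>i. i < m \<Longrightarrow> int p dvd coeff (pcompose (monic_poly n d) [:r, 1:]) i"
    and eq: "\<And>i. m \<le> i \<Longrightarrow> i < n \<Longrightarrow> c i = d i" and i: "i < m" "m \<le> n"
  shows "int p dvd c i - d i"
proof -
  define D where "D = monic_poly n c - monic_poly n d"
  have cD: "coeff D j = (if j < m then c j - d j else 0)" for j
    using eq i by (auto simp: D_def coeff_monic_poly)
  have deg: "degree D < m"
    using i by (intro le_less_trans[OF degree_le[of "m - 1"]]) (auto simp: cD)
  have "[:int p:] dvd pcompose D [:r, 1:]"
    unfolding const_poly_dvd_iff
  proof
    fix j
    show "int p dvd coeff (pcompose D [:r, 1:]) j"
    proof (cases "j < m")
      case True
      then show ?thesis using c d by (simp add: D_def pcompose_diff)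
    next
      case False
      then have "coeff (pcompose D [:r, 1:]) j = 0"
        using deg by (intro coeff_eq_0) (simp add: degree_pcompose)
      then show ?thesis by simp
    qed
  qed
  then obtain h where "pcompose D [:r, 1:] = [:int p:] * h" by blast
  then have "pcompose (pcompose D [:r, 1:]) [:- r, 1:] = [:int p:] * pcompose h [:- r, 1:]"
    by (simp add: pcompose_smult)
  moreover have "pcompose (pcompose D [:r, 1:]) [:- r, 1:] = D"
    unfolding pcompose_assoc[symmetric] by (simp add: pcompose_pCons)
  ultimately have "D = [:int p:] * pcompose h [:- r, 1:]" by (simp only:)
  then have "[:int p:] dvd D" by (rule dvdI)
  then have "int p dvd coeff D i" by (simp only: const_poly_dvd_iff)
  then show ?thesis using i by (simp add: cD)
qed

text \<open>Once the coefficients of index at least \<open>m\<close> are chosen, each of the others lies in a prescribed class modulo \<open>p\<close>,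
  and no class contains both \<open>u\<close> and \<open>v\<close>.\<close>

lemma card_taylor_coeffs_dvd:
  assumes S: "finite S" "u \<in> S" "v \<in> S" "\<not> int p dvd v - u" and m: "m \<le> n"
  shows "card {c \<in> PiE {..<n} (\<lambda>_. S). \<forall>i<m. int p dvd coeff (pcompose (monic_poly n c) [:r, 1:]) i}
     \<le> card S ^ (n - m) * (card S - 1) ^ m"
proof -
  define G where "G = {c \<in> PiE {..<n} (\<lambda>_. S). \<forall>i<m. int p dvd coeff (pcompose (monic_poly n c) [:r, 1:]) i}"
  define T where "T = PiE {m..<n} (\<lambda>_. S)"
  define fib where "fib t = {c \<in> G. restrict c {m..<n} = t}" for t
  have fT: "finite T" "card T = card S ^ (n - m)" using S by (auto simp: T_def finite_PiE card_PiE)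
  have "G = (\<Union>t\<in>T. fib t)"
    by (auto simp: fib_def T_def G_def PiE_iff)
  then have "card G \<le> (\<Sum>t\<in>T. card (fib t))" using fT by (simp add: card_UN_le)
  also have "\<dots> \<le> (\<Sum>t\<in>T. (card S - 1) ^ m)"
  proof (rule sum_mono)
    fix t assume "t \<in> T"
    show "card (fib t) \<le> (card S - 1) ^ m"
    proof (cases "fib t = {}")
      case False
      then obtain d where d: "d \<in> fib t" by blast
      define B where "B = PiE {..<m} (\<lambda>i. {s \<in> S. int p dvd s - d i})"
      have fB: "finite B" using S by (simp add: B_def finite_PiE)
      have tail: "c i = d i" if "c \<in> fib t" "m \<le> i" "i < n" for c i
      proof -
        have "restrict c {m..<n} i = restrict d {m..<n} i" using that d by (simp add: fib_def)
        then show ?thesis using that by simp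
      qed
      have "inj_on (\<lambda>c. restrict c {..<m}) (fib t)"
      proof (rule inj_onI)
        fix a b assume ab: "a \<in> fib t" "b \<in> fib t" "restrict a {..<m} = restrict b {..<m}"
        have P: "a \<in> PiE {..<n} (\<lambda>_. S)" "b \<in> PiE {..<n} (\<lambda>_. S)" using ab by (auto simp: fib_def G_def)
        show "a = b"
        proof (rule PiE_ext[OF P])
          fix i assume "i \<in> {..<n}"
          show "a i = b i"
          proof (cases "i < m")
            case True
            then show ?thesis using fun_cong[OF ab(3), of i] by simp
          next
            case False
            then show ?thesis using tail[OF ab(1), of i] tail[OF ab(2), of i] \<open>i \<in> {..<n}\<close> by simp
          qed
        qed
      qed
      moreover have "(\<lambda>c. restrict c {..<m}) ` fib t \<subseteq> B"
      proof safe
        fix c assume c: "c \<in> fib t"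
        have "int p dvd c i - d i" if i: "i < m" for i
          by (rule taylor_coeffs_determine[of m p n c r d])
            (use c d tail[OF c] m i in \<open>auto simp: fib_def G_def\<close>)
        moreover have "c i \<in> S" if "i < m" for i
          using c m that by (auto simp: fib_def G_def PiE_iff)
        ultimately show "restrict c {..<m} \<in> B" by (auto simp: B_def)
      qed
      ultimately have "card (fib t) \<le> card B" using fB by (metis card_inj_on_le)
      also have "card B = (\<Prod>i<m. card {s \<in> S. int p dvd s - d i})" by (simp add: B_def card_PiE)
      also have "\<dots> \<le> (\<Prod>i<m. card S - 1)"
      proof (rule prod_mono, safe)
        fix i
        have "\<not> (int p dvd u - d i \<and> int p dvd v - d i)"
          using S(4) dvd_diff[of "int p" "v - d i" "u - d i"] by auto
        then have "{s \<in> S. int p dvd s - d i} \<subset> S" using S by blast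
        then have "card {s \<in> S. int p dvd s - d i} < card S" using S by (simp add: psubset_card_mono)
        then show "card {s \<in> S. int p dvd s - d i} \<le> card S - 1" by simp
      qed
      finally show ?thesis by simp
    qed simp
  qed
  also have "\<dots> = card S ^ (n - m) * (card S - 1) ^ m" using fT by simp
  finally show ?thesis by (simp add: G_def)
qed

lemma mean_taylor_coeffs_dvd:
  assumes S: "finite S" "u \<in> S" "v \<in> S" "\<not> int p dvd v - u" and m: "m \<le> n"
  shows "mean_coeffs n S (\<lambda>c. of_bool (\<forall>i<m. int p dvd coeff (pcompose (monic_poly n c) [:r, 1:]) i))
     \<le> (1 - 1 / real (card S)) ^ m"
proof -
  have cS: "card S > 0" using S by (auto simp: card_gt_0_iff)
  have "mean_coeffs n S (\<lambda>c. of_bool (\<forall>i<m. int p dvd coeff (pcompose (monic_poly n c) [:r, 1:]) i))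
     = real (card {c \<in> PiE {..<n} (\<lambda>_. S). \<forall>i<m. int p dvd coeff (pcompose (monic_poly n c) [:r, 1:]) i})
       / real (card S) ^ n"
    using S by (simp add: mean_coeffs_def finite_PiE Int_def)
  also have "\<dots> \<le> real (card S ^ (n - m) * (card S - 1) ^ m) / real (card S) ^ n"
    using card_taylor_coeffs_dvd[OF S m, of r]
    by (intro divide_right_mono) (simp_all only: of_nat_le_iff zero_le_power of_nat_0_le_iff)
  also have "\<dots> = ((real (card S) - 1) / real (card S)) ^ m"
  proof -
    have "real (card S) ^ n = real (card S) ^ (n - m) * real (card S) ^ m"
      using m by (simp flip: power_add)
    then show ?thesis using cS by (simp add: power_divide of_nat_diff)
  qed
  also have "(real (card S) - 1) / real (card S) = 1 - 1 / real (card S)"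
    using cS by (simp add: field_simps)
  finally show ?thesis .
qed

section \<open>The expected number of roots at a fixed precision\<close>

lemma card_unit_residues:
  assumes p: "prime p" and k: "k > 0"
  shows "real (card (unit_residues p k)) = real p ^ k * (1 - 1 / real p)"
proof -
  obtain j where j: "k = Suc j" using k by (cases k) auto
  have p0: "p > 0" using prime_gt_0_nat[OF p] .
  have inj: "inj_on (\<lambda>x. int p * x) {0..<int p ^ j}" using p0 by (auto simp: inj_on_def)
  have eq: "{0..<int p ^ k} - unit_residues p k = (\<lambda>x. int p * x) ` {0..<int p ^ j}"
  proof safe
    fix x assume x: "x \<in> {0..<int p ^ k}" "x \<notin> unit_residues p k"
    then obtain y where y: "x = int p * y" by (auto simp: unit_residues_def)
    then have "0 \<le> y" "y < int p ^ j" using x p0 by (auto simp: j zero_le_mult_iff)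
    then show "x \<in> (\<lambda>x. int p * x) ` {0..<int p ^ j}" using y by auto
  qed (use p0 in \<open>auto simp: j unit_residues_def\<close>)
  have sub: "unit_residues p k \<subseteq> {0..<int p ^ k}" by (auto simp: unit_residues_def)
  have "card {0..<int p ^ k} = card (unit_residues p k \<union> ({0..<int p ^ k} - unit_residues p k))"
    using sub by (intro arg_cong[where f = card]) auto
  also have "\<dots> = card (unit_residues p k) + card ({0..<int p ^ k} - unit_residues p k)"
    by (intro card_Un_disjoint finite_unit_residues) auto
  also have "card ({0..<int p ^ k} - unit_residues p k) = p ^ j"
    unfolding eq using inj by (simp add: card_image nat_power_eq)
  finally have "p ^ k = card (unit_residues p k) + p ^ j" by (simp add: nat_power_eq)
  then have "real (p ^ k) = real (card (unit_residues p k)) + real (p ^ j)"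
    by (simp only: of_nat_add)
  then show ?thesis using p0 by (simp add: j field_simps)
qed

text \<open>Each summand is the probability that \<open>p\<close> to the power \<open>k + v\<close> divides \<open>f(r)\<close> and \<open>p\<^sup>v\<close> exactly divides \<open>f'(r)\<close> under
  perfect uniformity; summed over the \<open>p\<^sup>k (1 - 1/p)\<close> units, these give a geometric series with ratio \<open>p\<^sup>-\<^sup>2\<close>.\<close>

lemma main_term:
  assumes p: "prime p" and k: "k > 0"
  shows "(\<Sum>r\<in>unit_residues p k. \<Sum>v<k. 1 / real p ^ (k + v + v) - 1 / real p ^ (k + v + Suc v))
     = (real p - 1) / (real p + 1) * (1 - 1 / real p ^ (2 * k))"
proof -
  define x where "x = 1 / real p"
  have p1: "real p > 1" using prime_gt_1_nat[OF p] by simp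
  have x: "0 < x" "x < 1" using p1 by (auto simp: x_def)
  have "(x ^ 2) \<noteq> 1" using x power_strict_decreasing[of 0 2 x] by simp
  then have "(\<Sum>v<k. (x\<^sup>2) ^ v) = ((x\<^sup>2) ^ k - 1) / (x\<^sup>2 - 1)" by (rule geometric_sum)
  also have "\<dots> = (1 - (x\<^sup>2) ^ k) / (1 - x\<^sup>2)" by (metis minus_diff_eq minus_divide_divide)
  finally have geo: "(\<Sum>v<k. (x\<^sup>2) ^ v) = (1 - x ^ (2 * k)) / (1 - x\<^sup>2)"
    by (simp add: power_mult)
  have "1 / real p ^ (k + v + v) - 1 / real p ^ (k + v + Suc v) = x ^ k * (1 - x) * (x\<^sup>2) ^ v" for v
  proof -
    have "x ^ (k + v + v) - x ^ (k + v + Suc v) = x ^ k * (1 - x) * (x\<^sup>2) ^ v"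
      by (simp add: power_add algebra_simps power_mult_distrib power2_eq_square)
    then show ?thesis by (simp only: x_def power_one_over)
  qed
  then have "(\<Sum>r\<in>unit_residues p k. \<Sum>v<k. 1 / real p ^ (k + v + v) - 1 / real p ^ (k + v + Suc v))
     = real (card (unit_residues p k)) * (x ^ k * (1 - x) * (\<Sum>v<k. (x\<^sup>2) ^ v))"
    by (simp add: sum_distrib_left)
  also have "\<dots> = (real p ^ k * x ^ k) * (1 - x) * (1 - x) * ((1 - x ^ (2 * k)) / (1 - x\<^sup>2))"
    unfolding card_unit_residues[OF p k] geo by (simp add: x_def)
  also have "real p ^ k * x ^ k = 1" using p1 by (simp add: x_def power_one_over)
  also have "1 * (1 - x) * (1 - x) * ((1 - x ^ (2 * k)) / (1 - x\<^sup>2)) = (1 - x) / (1 + x) * (1 - x ^ (2 * k))"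
  proof -
    have "1 - x\<^sup>2 = (1 - x) * (1 + x)" by (simp add: power2_eq_square algebra_simps)
    then show ?thesis using x by simp
  qed
  also have "(1 - x) / (1 + x) = (real p - 1) / (real p + 1)"
  proof -
    have "1 - x = (real p - 1) / real p" "1 + x = (real p + 1) / real p"
      using p1 by (simp_all add: x_def field_simps)
    then show ?thesis using p1 by simp
  qed
  finally show ?thesis by (simp add: x_def power_one_over)
qed

text \<open>The terms of the bound are, in this order: the truncation of the geometric series; the deviation from
  uniformity in the simple roots; the roots at which \<open>f'\<close> vanishes modulo \<open>p\<^sup>k\<close>, which exist with
  probability at most \<open>p\<^sup>k (p\<^sup>-\<^sup>2\<^sup>k + E)\<close> and number at most \<open>p m\<close> outside the degenerate case; and the degenerate case.\<close>

lemma expected_roots_error: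
  fixes S :: "int set" and u v :: int
  assumes p: "prime p" and S: "finite S" "u \<in> S" "v \<in> S" "\<not> int p dvd v - u"
    and unit: "\<And>s. s \<in> S \<Longrightarrow> int p dvd s \<Longrightarrow> s = 0"
    and iid: "iid_uniform M n \<xi> S" and n: "n > 0" and k: "k > 0" and m: "m \<le> n"
  defines "E \<equiv> (1 - 1 / (4 * real (card S) * (real (p ^ (2 * k)))\<^sup>2)) ^ (n div 2)"
    and "\<beta> \<equiv> 1 - 1 / real (card S)"
  shows "\<bar>expected_roots p M n \<xi> - ((real p - 1) / (real p + 1) + of_bool (0 \<in> S) / real (card S))\<bar>
    \<le> 1 / real p ^ (2 * k) + 2 * real k * real p ^ k * E
      + real p * real m * (1 / real p ^ k + real p ^ k * E)
      + (real p * real n * \<beta> ^ m) * real p ^ k"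
proof -
  let ?f = "monic_poly n"
  have S0: "finite S" "S \<noteq> {}" using S by auto
  have p1: "real p > 1" using prime_gt_1_nat[OF p] by simp
  have cS: "real (card S) \<ge> 1" using S(1,2) by (auto simp: Suc_le_eq card_gt_0_iff)
  have E0: "E \<ge> 0"
    using contraction_factor_nonneg[OF cS, of "real (p ^ (2 * k))"] p1 by (simp add: E_def)
  have \<beta>0: "\<beta> \<ge> 0" using cS by (simp add: \<beta>_def)
  have cU: "real (card (unit_residues p j)) \<le> real p ^ j" if "j > 0" for j
    unfolding card_unit_residues[OF p that] using p1 by (simp add: field_simps)
  define Ind where "Ind i j r c = (of_bool (int p ^ i dvd poly (?f c) r \<and> int p ^ j dvd poly (pderiv (?f c)) r) :: real)"
    for i j r c
  define Deg where "Deg r c = (of_bool (\<forall>i<m. int p dvd coeff (pcompose (?f c) [:r, 1:]) i) :: real)" for r c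
  define G where "G c = (\<Sum>r\<in>unit_residues p k. \<Sum>v<k. Ind (k + v) v r c - Ind (k + v) (Suc v) r c)" for c
  define B where "B c = real (card {a \<in> unit_roots p (?f c). int p ^ k dvd poly (pderiv (?f c)) (a k)})" for c
  define W where "W c = real p * real m * (\<Sum>r\<in>unit_residues p k. Ind k k r c)
     + real n * real p ^ k * (\<Sum>r\<in>unit_residues p 1. Deg r c)" for c
  have "expected_roots p M n \<xi> = mean_coeffs n S (\<lambda>c. of_bool (c 0 = 0) + G c + B c)"
    unfolding expected_roots_eq_mean[OF iid S0 n]
  proof (rule mean_coeffs_cong)
    fix c assume c: "c \<in> PiE {..<n} (\<lambda>_. S)"
    have "coeff (?f c) i = 0" if "int p dvd coeff (?f c) i" for i
      using that c unit[of "c i"] prime_gt_1_nat[OF p]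
      by (auto simp: coeff_monic_poly PiE_iff split: if_splits)
    from residue_roots_split[OF p k lead_coeff_monic_poly this]
    show "real (num_roots (padic_field p) (?f c)) = of_bool (c 0 = 0) + G c + B c"
      using n by (simp add: num_roots_padic_field[OF p lead_coeff_monic_poly] card_simple_unit_roots[OF p k]
          G_def B_def Ind_def coeff_monic_poly)
  qed
  also have "\<dots> = of_bool (0 \<in> S) / real (card S) + mean_coeffs n S G + mean_coeffs n S B"
    by (simp add: mean_coeffs_add mean_coeffs_first_zero[OF S0 n])
  finally have mean: "expected_roots p M n \<xi> = of_bool (0 \<in> S) / real (card S) + mean_coeffs n S G + mean_coeffs n S B" .
  have equi: "\<bar>mean_coeffs n S (Ind i j r) - 1 / real p ^ (i + j)\<bar> \<le> E"
    if "i \<le> 2 * k" "j \<le> 2 * k" "r \<in> unit_residues p l" for i j r l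
    using equidistribution[OF p S _ that(1,2), of r n] that(3)
    by (simp add: Ind_def[abs_def] E_def unit_residues_def)
  define main where "main = (\<Sum>r\<in>unit_residues p k. \<Sum>v<k. 1 / real p ^ (k + v + v) - 1 / real p ^ (k + v + Suc v))"
  have "mean_coeffs n S G = (\<Sum>r\<in>unit_residues p k. \<Sum>v<k.
      mean_coeffs n S (Ind (k + v) v r) - mean_coeffs n S (Ind (k + v) (Suc v) r))"
    by (simp add: G_def[abs_def] mean_coeffs_sum mean_coeffs_diff)
  then have "mean_coeffs n S G - main = (\<Sum>r\<in>unit_residues p k. \<Sum>v<k.
      (mean_coeffs n S (Ind (k + v) v r) - 1 / real p ^ (k + v + v))
      - (mean_coeffs n S (Ind (k + v) (Suc v) r) - 1 / real p ^ (k + v + Suc v)))"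
    unfolding main_def by (simp only: sum_subtractf[symmetric]) (intro sum.cong refl, simp)
  moreover have "\<bar>\<Sum>r\<in>unit_residues p k. \<Sum>v<k.
      (mean_coeffs n S (Ind (k + v) v r) - 1 / real p ^ (k + v + v))
      - (mean_coeffs n S (Ind (k + v) (Suc v) r) - 1 / real p ^ (k + v + Suc v))\<bar>
      \<le> (\<Sum>r\<in>unit_residues p k. \<Sum>v<k. 2 * E)"
  proof (intro order_trans[OF sum_abs] sum_mono)
    fix r v assume "r \<in> unit_residues p k" "v \<in> {..<k}"
    then have "\<bar>mean_coeffs n S (Ind (k + v) v r) - 1 / real p ^ (k + v + v)\<bar> \<le> E"
      and "\<bar>mean_coeffs n S (Ind (k + v) (Suc v) r) - 1 / real p ^ (k + v + Suc v)\<bar> \<le> E"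
      by (intro equi[of _ _ _ k]; simp)+
    then show "\<bar>(mean_coeffs n S (Ind (k + v) v r) - 1 / real p ^ (k + v + v))
      - (mean_coeffs n S (Ind (k + v) (Suc v) r) - 1 / real p ^ (k + v + Suc v))\<bar> \<le> 2 * E"
      by linarith
  qed
  moreover have "(\<Sum>r\<in>unit_residues p k. \<Sum>v<k. 2 * E) \<le> real p ^ k * (2 * real k * E)"
    using mult_right_mono[OF cU[OF k], of "2 * real k * E"] E0 by (simp add: mult_ac)
  ultimately have G: "\<bar>mean_coeffs n S G - main\<bar> \<le> 2 * real k * real p ^ k * E" by (simp add: mult_ac)
  have "\<bar>main - (real p - 1) / (real p + 1)\<bar> \<le> 1 / real p ^ (2 * k)"
  proof -
    have "main - (real p - 1) / (real p + 1) = - ((real p - 1) / (real p + 1) * (1 / real p ^ (2 * k)))"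
      unfolding main_def main_term[OF p k] right_diff_distrib by simp
    also have "\<bar>\<dots>\<bar> = (real p - 1) / (real p + 1) * (1 / real p ^ (2 * k))"
      using p1 by (simp add: abs_mult)
    also have "\<dots> \<le> 1 * (1 / real p ^ (2 * k))"
      using p1 by (intro mult_right_mono) auto
    finally show ?thesis by simp
  qed
  moreover have "0 \<le> mean_coeffs n S B"
    unfolding mean_coeffs_def B_def by (intro divide_nonneg_nonneg sum_nonneg) auto
  moreover have "mean_coeffs n S B \<le> mean_coeffs n S W"
  proof (rule mean_coeffs_mono)
    fix c
    define I where "I = (\<Sum>r\<in>unit_residues p k. Ind k k r c)"
    define D where "D = (\<Sum>r\<in>unit_residues p 1. Deg r c)"
    have I0: "0 \<le> I" "0 \<le> D" by (simp_all add: I_def D_def Ind_def Deg_def sum_nonneg)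
    have "I \<le> (\<Sum>r\<in>unit_residues p k. 1)" unfolding I_def by (intro sum_mono) (simp add: Ind_def)
    also have "\<dots> \<le> real p ^ k" using cU[OF k] by simp
    finally have I1: "I \<le> real p ^ k" .
    have "B c \<le> real (card (unit_roots p (?f c))) * I"
      using card_multiple_unit_roots[OF p k lead_coeff_monic_poly, of n c] by (simp add: B_def I_def Ind_def)
    also have "\<dots> \<le> (real p * real m + real n * D) * I"
      using card_unit_roots_le[OF p lead_coeff_monic_poly, of n c m] I0
      by (intro mult_right_mono) (simp_all add: degree_monic_poly D_def Deg_def)
    also have "\<dots> = real p * real m * I + real n * D * I" by (simp add: algebra_simps)
    also have "\<dots> \<le> real p * real m * I + real n * D * real p ^ k"
      using I1 I0 by (intro add_left_mono mult_left_mono) auto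
    finally show "B c \<le> W c" by (simp add: W_def I_def D_def mult_ac)
  qed
  moreover have "mean_coeffs n S W \<le> real p * real m * (1 / real p ^ k + real p ^ k * E)
      + (real p * real n * \<beta> ^ m) * real p ^ k"
  proof -
    have "(\<Sum>r\<in>unit_residues p k. mean_coeffs n S (Ind k k r)) \<le> (\<Sum>r\<in>unit_residues p k. 1 / real p ^ (k + k) + E)"
    proof (rule sum_mono)
      fix r assume "r \<in> unit_residues p k"
      from equi[OF _ _ this, of k k] show "mean_coeffs n S (Ind k k r) \<le> 1 / real p ^ (k + k) + E"
        by simp
    qed
    also have "\<dots> = real (card (unit_residues p k)) * (1 / real p ^ (k + k) + E)" by simp
    also have "\<dots> \<le> real p ^ k * (1 / real p ^ (k + k) + E)"
      using cU[OF k] E0 by (intro mult_right_mono) auto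
    also have "\<dots> = 1 / real p ^ k + real p ^ k * E" using p1 by (simp add: power_add distrib_left)
    finally have 1: "(\<Sum>r\<in>unit_residues p k. mean_coeffs n S (Ind k k r)) \<le> 1 / real p ^ k + real p ^ k * E" .
    have "(\<Sum>r\<in>unit_residues p 1. mean_coeffs n S (Deg r)) \<le> (\<Sum>r\<in>unit_residues p 1. \<beta> ^ m)"
      unfolding Deg_def[abs_def] \<beta>_def by (intro sum_mono mean_taylor_coeffs_dvd[OF S m])
    also have "\<dots> \<le> real p * \<beta> ^ m" using cU[of 1] \<beta>0 by (simp add: mult_right_mono)
    finally have 2: "(\<Sum>r\<in>unit_residues p 1. mean_coeffs n S (Deg r)) \<le> real p * \<beta> ^ m" .
    have "mean_coeffs n S W = real p * real m * (\<Sum>r\<in>unit_residues p k. mean_coeffs n S (Ind k k r))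
      + real n * real p ^ k * (\<Sum>r\<in>unit_residues p 1. mean_coeffs n S (Deg r))"
      by (simp add: W_def[abs_def] mean_coeffs_add mean_coeffs_cmult mean_coeffs_sum)
    also have "\<dots> \<le> real p * real m * (1 / real p ^ k + real p ^ k * E) + real n * real p ^ k * (real p * \<beta> ^ m)"
      using 1 2 by (intro add_mono mult_left_mono) auto
    finally show ?thesis by (simp add: mult_ac)
  qed
  ultimately show ?thesis using G unfolding mean by linarith
qed

section \<open>Choice of the precision and asymptotics\<close>

text \<open>The precision \<open>k\<close> is chosen with \<open>p\<^sup>k \<le> h < p\<^sup>k p\<close>, where \<open>h\<close> is slightly below the fourth root of \<open>n\<close>. Then
  \<open>n/q\<^sup>2\<close> with \<open>q = p\<^sup>2\<^sup>k\<close> is still at least a positive power of \<open>n\<close>, which makes \<open>E\<close> exponentially small in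
  that power.\<close>

lemma expected_roots_error_explicit:
  fixes S :: "int set" and u v :: int and \<eta> :: real
  assumes p: "prime p" and S: "finite S" "u \<in> S" "v \<in> S" "\<not> int p dvd v - u"
    and unit: "\<And>s. s \<in> S \<Longrightarrow> int p dvd s \<Longrightarrow> s = 0"
    and iid: "iid_uniform M n \<xi> S" and n: "n \<ge> 2" and \<eta>: "0 < \<eta>" "\<eta> < 1 / 8"
  defines "h \<equiv> real n powr (1 / 4 - 2 * \<eta>)" and "s \<equiv> real (card S)"
  assumes large: "real p \<le> h"
  defines "E \<equiv> exp (- (real n powr (8 * \<eta>) / (16 * s)))"
  shows "\<bar>expected_roots p M n \<xi> - ((real p - 1) / (real p + 1) + of_bool (0 \<in> S) / real (card S))\<bar>
    \<le> real p / h + 2 * h\<^sup>2 * E + real p * real n powr \<eta> * (real p / h)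
      + real p * real n powr \<eta> * (h * E)
      + (real p * real n * exp (- ((real n powr \<eta> - 1) / s))) * h"
proof -
  have p1: "real p > 1" using prime_gt_1_nat[OF p] by simp
  have s1: "s \<ge> 1" using S(1,2) unfolding s_def by (auto simp: Suc_le_eq card_gt_0_iff)
  have h0: "h > 0" using large p1 by linarith
  define k where "k = nat \<lfloor>log p h\<rfloor>"
  define m where "m = nat \<lfloor>real n powr \<eta>\<rfloor>"
  have log1: "log p h \<ge> 1" using large p1 h0 by (simp add: le_log_iff)
  then have k: "k > 0" by (simp add: k_def)
  have "real k \<le> log p h" "log p h < real k + 1"
    using log1 unfolding k_def by linarith+
  then have "real p powr real k \<le> h" "h < real p powr (real k + 1)"
    using p1 h0 by (simp_all add: le_log_iff log_less_iff)
  then have pk: "real p ^ k \<le> h" "h < real p ^ k * real p"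
    using p1 by (simp_all add: powr_add powr_realpow)
  have mle: "real m \<le> real n powr \<eta>" and mge: "real n powr \<eta> - 1 \<le> real m"
    by (simp_all add: m_def)
  have "real n powr \<eta> \<le> real n powr 1" using n \<eta> by (intro powr_mono) auto
  then have mn: "m \<le> n" using mle n by simp
  define y where "y = 1 / (4 * s * (real (p ^ (2 * k)))\<^sup>2)"
  define E' where "E' = (1 - y) ^ (n div 2)"
  define \<beta> where "\<beta> = 1 - 1 / s"
  have inv: "1 / real p ^ k \<le> real p / h"
    using pk p1 h0 by (simp add: field_simps)
  have inv2: "1 / real p ^ (2 * k) \<le> real p / h"
  proof -
    have "real p ^ k \<le> real p ^ (2 * k)" using p1 by (intro power_increasing) auto
    then have "1 / real p ^ (2 * k) \<le> 1 / real p ^ k" using p1 by (intro divide_left_mono) auto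
    then show ?thesis using inv by linarith
  qed
  have kh: "real k \<le> h"
  proof -
    have "k < p ^ k" using prime_gt_1_nat[OF p] by (intro power_gt_expt) auto
    then have "real k \<le> real p ^ k" by (metis less_imp_le of_nat_le_iff of_nat_power)
    then show ?thesis using pk by linarith
  qed
  have y: "y \<le> 1" "0 \<le> y" "real n powr (8 * \<eta>) / (16 * s) \<le> y * real (n div 2)"
  proof -
    show "y \<le> 1" using contraction_factor_nonneg[OF s1, of "real (p ^ (2 * k))"] p1 by (simp add: y_def)
    show "0 \<le> y" using s1 by (simp add: y_def)
    have "(real (p ^ (2 * k)))\<^sup>2 = (real p ^ k) ^ 4" by (simp add: mult.commute flip: power_mult)
    also have "\<dots> \<le> h ^ 4" using pk p1 by (intro power_mono) auto
    also have "h ^ 4 = real n powr (1 - 8 * \<eta>)"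
      using n by (simp add: h_def powr_power)
    also have "\<dots> = real n / real n powr (8 * \<eta>)"
      using n by (simp add: powr_diff)
    finally have q: "(real (p ^ (2 * k)))\<^sup>2 \<le> real n / real n powr (8 * \<eta>)" .
    have "real n powr (8 * \<eta>) / (16 * s) = 1 / (4 * s * (real n / real n powr (8 * \<eta>))) * (real n / 4)"
      using n s1 by (simp add: field_simps)
    also have "\<dots> \<le> y * (real n / 4)"
      unfolding y_def using q p1 s1 n by (intro mult_right_mono divide_left_mono mult_left_mono) auto
    also have "\<dots> \<le> y * real (n div 2)"
    proof -
      have "n \<le> 4 * (n div 2)" using n by presburger
      then have "real n / 4 \<le> real (n div 2)" by linarith
      then show ?thesis using \<open>0 \<le> y\<close> by (rule mult_left_mono)
    qed
    finally show "real n powr (8 * \<eta>) / (16 * s) \<le> y * real (n div 2)" .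
  qed
  have "1 - y \<le> exp (- y)" using exp_ge_add_one_self[of "- y"] by simp
  then have "E' \<le> exp (- y) ^ (n div 2)" unfolding E'_def using y by (intro power_mono) auto
  also have "\<dots> = exp (- (y * real (n div 2)))" by (simp add: exp_of_nat_mult[symmetric] mult.commute)
  also have "\<dots> \<le> E" unfolding E_def using y(3) by simp
  finally have E': "E' \<le> E" .
  have \<beta>0: "\<beta> \<ge> 0" using s1 by (simp add: \<beta>_def)
  have "\<beta> \<le> exp (- (1 / s))" using exp_ge_add_one_self[of "- (1 / s)"] by (simp add: \<beta>_def)
  then have "\<beta> ^ m \<le> exp (- (1 / s)) ^ m" using \<beta>0 by (intro power_mono)
  also have "\<dots> = exp (- (real m / s))" by (simp add: exp_of_nat_mult[symmetric])
  also have "\<dots> \<le> exp (- ((real n powr \<eta> - 1) / s))" using mge s1 by (simp add: divide_right_mono)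
  finally have \<beta>: "\<beta> ^ m \<le> exp (- ((real n powr \<eta> - 1) / s))" .
  have E0: "E \<ge> 0" by (simp add: E_def)
  have kk: "real k * real p ^ k \<le> h\<^sup>2"
    unfolding power2_eq_square using kh pk h0 p1 by (intro mult_mono) auto
  have "\<bar>expected_roots p M n \<xi> - ((real p - 1) / (real p + 1) + of_bool (0 \<in> S) / real (card S))\<bar>
    \<le> 1 / real p ^ (2 * k) + 2 * real k * real p ^ k * E'
      + real p * real m * (1 / real p ^ k + real p ^ k * E') + (real p * real n * \<beta> ^ m) * real p ^ k"
    using expected_roots_error[OF p S unit iid _ k mn] n by (simp add: E'_def y_def \<beta>_def s_def)
  moreover have "2 * real k * real p ^ k * E' \<le> 2 * h\<^sup>2 * E"
  proof -
    have "2 * (real k * real p ^ k) * E' \<le> 2 * h\<^sup>2 * E"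
      using kk E' E0 y h0 by (intro mult_mono) (auto simp: E'_def)
    then show ?thesis by (simp add: mult_ac)
  qed
  moreover have "real p * real m * (1 / real p ^ k + real p ^ k * E')
      \<le> real p * real n powr \<eta> * (real p / h + h * E)"
    using mle inv pk E' E0 y p1 h0 by (intro mult_mono add_mono) (auto simp: E'_def)
  moreover have "(real p * real n * \<beta> ^ m) * real p ^ k \<le>
      (real p * real n * exp (- ((real n powr \<eta> - 1) / s))) * h"
    using \<beta> pk p1 h0 \<beta>0 by (intro mult_mono) auto
  ultimately show ?thesis using inv2 by (simp add: distrib_left)
qed

text \<open>Of the five error terms, those with an exponential are negligible; the dominant one is of order \<open>n\<^sup>\<eta> / h\<close>, which
  is \<open>n\<close> to the power \<open>-1/4 + 3\<eta>\<close>.\<close>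

theorem expected_roots_asymptotics:
  fixes S :: "int set" and u v :: int and \<epsilon> :: real
    and M :: "nat \<Rightarrow> 'a measure" and \<xi> :: "nat \<Rightarrow> nat \<Rightarrow> 'a \<Rightarrow> int"
  assumes p: "prime p" and \<epsilon>: "\<epsilon> > 0"
    and S: "finite S" "u \<in> S" "v \<in> S" "\<not> int p dvd v - u"
    and unit: "\<And>s. s \<in> S \<Longrightarrow> int p dvd s \<Longrightarrow> s = 0"
    and iid: "\<And>n. iid_uniform (M n) n (\<xi> n) S"
  shows "(\<lambda>n. expected_roots p (M n) n (\<xi> n) -
      ((real p - 1) / (real p + 1) + of_bool (0 \<in> S) / real (card S)))
    \<in> O(\<lambda>n. real n powr (- 1 / 4 + \<epsilon>))"
proof -
  \<comment> \<open>the cap keeps the exponent of \<open>h\<close> positive when \<open>\<epsilon>\<close> is large\<close>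
  define \<eta> where "\<eta> = min (\<epsilon> / 4) (1 / 16)"
  have \<eta>: "0 < \<eta>" "\<eta> < 1 / 8" "4 * \<eta> \<le> \<epsilon>" using \<epsilon> by (auto simp: \<eta>_def)
  define s P where "s = real (card S)" and "P = real p"
  have s: "s > 0" using S(1,2) unfolding s_def by (auto simp: card_gt_0_iff)
  have P: "P > 0" using prime_gt_0_nat[OF p] by (simp add: P_def)
  let ?h = "\<lambda>n::nat. real n powr (1 / 4 - 2 * \<eta>)"
  let ?E = "\<lambda>n::nat. exp (- (real n powr (8 * \<eta>) / (16 * s)))"
  let ?g = "\<lambda>n::nat. real n powr (- 1 / 4 + 4 * \<eta>)"
  let ?err = "\<lambda>n::nat. P / ?h n + 2 * (?h n)\<^sup>2 * ?E n + P * real n powr \<eta> * (P / ?h n)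
      + P * real n powr \<eta> * (?h n * ?E n)
      + (P * real n * exp (- ((real n powr \<eta> - 1) / s))) * ?h n"
  have "filterlim ?h at_top at_top" using \<eta> by real_asymp
  then have "\<forall>\<^sub>F n in at_top. P \<le> ?h n" by (simp add: filterlim_at_top)
  then have "\<forall>\<^sub>F n in at_top. \<bar>expected_roots p (M n) n (\<xi> n) -
      ((real p - 1) / (real p + 1) + of_bool (0 \<in> S) / real (card S))\<bar> \<le> ?err n"
    using eventually_ge_at_top[of 2]
  proof eventually_elim
    case (elim n)
    then show ?case
      using expected_roots_error_explicit[OF p S unit iid elim(2) \<eta>(1,2)] by (simp add: s_def P_def)
  qed
  then have "(\<lambda>n. expected_roots p (M n) n (\<xi> n) -
      ((real p - 1) / (real p + 1) + of_bool (0 \<in> S) / real (card S))) \<in> O(?err)"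
    by (intro bigoI[of _ 1]) (auto elim!: eventually_mono)
  also have "?err \<in> O(?g)"
  proof (intro sum_in_bigo)
    show "(\<lambda>n. P / ?h n) \<in> O(?g)" using \<eta> by real_asymp
    show "(\<lambda>n. 2 * (?h n)\<^sup>2 * ?E n) \<in> O(?g)" using \<eta> s by real_asymp
    show "(\<lambda>n. P * real n powr \<eta> * (P / ?h n)) \<in> O(?g)" using \<eta> P by real_asymp
    show "(\<lambda>n. P * real n powr \<eta> * (?h n * ?E n)) \<in> O(?g)" using \<eta> s P by real_asymp
    show "(\<lambda>n. (P * real n * exp (- ((real n powr \<eta> - 1) / s))) * ?h n) \<in> O(?g)"
      using \<eta> s P by real_asymp
  qed
  also have "?g \<in> O(\<lambda>n. real n powr (- 1 / 4 + \<epsilon>))"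
    using \<eta>(3) by (intro bigoI[of _ 1] eventually_mono[OF eventually_ge_at_top[of 1]])
      (auto intro!: powr_mono)
  finally show ?thesis .
qed

theorem corollary2:
  fixes p :: nat and \<epsilon> :: real
    and M :: "nat \<Rightarrow> 'a measure" and \<xi> :: "nat \<Rightarrow> nat \<Rightarrow> 'a \<Rightarrow> int"
  assumes "prime p" and "\<epsilon> > 0"
  shows
    "(p > 2 \<and> (\<forall>n. iid_uniform (M n) n (\<xi> n) {-1, 1}) \<longrightarrow>
        (\<lambda>n. expected_roots p (M n) n (\<xi> n) - (real p - 1) / (real p + 1))
          \<in> O(\<lambda>n. real n powr (- 1 / 4 + \<epsilon>))) \<and>
     ((\<forall>n. iid_uniform (M n) n (\<xi> n) {0, 1}) \<longrightarrow>
        (\<lambda>n. expected_roots p (M n) n (\<xi> n) - (3 * real p - 1) / (2 * (real p + 1)))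
          \<in> O(\<lambda>n. real n powr (- 1 / 4 + \<epsilon>))) \<and>
     ((\<forall>n. iid_uniform (M n) n (\<xi> n) {0..int p - 1}) \<longrightarrow>
        (\<lambda>n. expected_roots p (M n) n (\<xi> n) - ((real p)\<^sup>2 + 1) / (real p * (real p + 1)))
          \<in> O(\<lambda>n. real n powr (- 1 / 4 + \<epsilon>)))"
proof (intro conjI impI)
  note p = assms(1)
  have p1: "real p > 1" "int p > 1" using prime_gt_1_nat[OF p] by simp_all
  show "(\<lambda>n. expected_roots p (M n) n (\<xi> n) - (real p - 1) / (real p + 1))
      \<in> O(\<lambda>n. real n powr (- 1 / 4 + \<epsilon>))"
    if "p > 2 \<and> (\<forall>n. iid_uniform (M n) n (\<xi> n) {-1, 1})"
  proof -
    have "\<not> int p dvd 2" using that zdvd_imp_le[of "int p" 2] by auto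
    moreover have "s = 0" if "s \<in> {-1, 1}" "int p dvd s" for s
      using that p1 by (auto simp: zdvd1_eq)
    ultimately show ?thesis
      using expected_roots_asymptotics[OF p assms(2), of "{-1, 1}" "-1" 1 M \<xi>] that p1 by auto
  qed
  show "(\<lambda>n. expected_roots p (M n) n (\<xi> n) - (3 * real p - 1) / (2 * (real p + 1)))
      \<in> O(\<lambda>n. real n powr (- 1 / 4 + \<epsilon>))"
    if "\<forall>n. iid_uniform (M n) n (\<xi> n) {0, 1}"
  proof -
    have "(real p - 1) / (real p + 1) + 1 / 2 = (3 * real p - 1) / (2 * (real p + 1))"
      using p1 by (simp add: field_simps)
    moreover have "s = 0" if "s \<in> {0, 1}" "int p dvd s" for s
      using that p1 by (auto simp: zdvd1_eq)
    ultimately show ?thesis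
      using expected_roots_asymptotics[OF p assms(2), of "{0, 1}" 0 1 M \<xi>] that p1 by auto
  qed
  show "(\<lambda>n. expected_roots p (M n) n (\<xi> n) - ((real p)\<^sup>2 + 1) / (real p * (real p + 1)))
      \<in> O(\<lambda>n. real n powr (- 1 / 4 + \<epsilon>))"
    if "\<forall>n. iid_uniform (M n) n (\<xi> n) {0..int p - 1}"
  proof -
    have "(real p - 1) / (real p + 1) + 1 / real p = ((real p)\<^sup>2 + 1) / (real p * (real p + 1))"
      using p1 by (simp add: field_simps power2_eq_square)
    moreover have "s = 0" if "s \<in> {0..int p - 1}" "int p dvd s" for s
      using that zdvd_imp_le[of "int p" s] by force
    ultimately show ?thesis
      using expected_roots_asymptotics[OF p assms(2), of "{0..int p - 1}" 0 1 M \<xi>] that p1 by auto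
  qed
qed

end
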